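(* Let $n\ge 3$ be an integer and $p$ a prime number. Then every pro-$p$ Demushkin group has the vanishing $n$-fold Massey product property with respect to $\mathbb{F}_p$.
   Context: A pro-$p$ group $G$ is Demushkin if $\dim_{\mathbb{F}_p}H^1(G,\mathbb{F}_p)<\infty$, $\dim_{\mathbb{F}_p}H^2(G,\mathbb{F}_p)=1$, and the cup product $H^1(G,\mathbb{F}_p)\times H^1(G,\mathbb{F}_p)\to H^2(G,\mathbb{F}_p)$ is non-degenerate. Massey products: in the DGA $\mathcal{C}^\bullet(G,\mathbb{F}_p)$ of inhomogeneous continuous cochains (cup product, differential $\partial$), for $\alpha_1,\dots,\alpha_n\in H^1(G,\mathbb{F}_p)$ a defining system is $M=(a_{ij})$, $1\le i<j\le n+1$, $(i,j)\ne(1,n+1)$, of $1$-cochains with $a_{i,i+1}$ representing $\alpha_i$ and $\partial a_{ij}=\sum_{l=i+1}^{j-1}a_{il}\cup a_{lj}$ for $j>i+1$; its value is the class of $\sum_{k=2}^n a_{1k}\cup a_{k,n+1}$, and $\langle\alpha_1,\dots,\alpha_n\rangle\subseteq H^2(G,\mathbb{F}_p)$ is the set of all values. $G$ has the vanishing $n$-fold Massey product property w.r.t. $\mathbb{F}_p$ if every defined (nonempty) such product contains $0$. *)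

theory Defs
  imports
    "HOL-Analysis.Abstract_Topological_Spaces"
    "HOL-Number_Theory.Residues"
    "Jordan_Normal_Form.Missing_VectorSpace"
begin

definition topological_group :: "('g, 'm) monoid_scheme \<Rightarrow> 'g topology \<Rightarrow> bool" where
  "topological_group G T \<longleftrightarrow>
     group G \<and> topspace T = carrier G \<and>
     continuous_map (prod_topology T T) T (\<lambda>(x, y). x \<otimes>\<^bsub>G\<^esub> y) \<and>
     continuous_map T T (\<lambda>x. inv\<^bsub>G\<^esub> x)"

definition profinite_group :: "('g, 'm) monoid_scheme \<Rightarrow> 'g topology \<Rightarrow> bool" where
  "profinite_group G T \<longleftrightarrow>
     topological_group G T \<and> compact_space T \<and> Hausdorff_space T \<and>
     (\<forall>x \<in> topspace T. connected_component_of_set T x = {x})"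

definition pro_p_group :: "nat \<Rightarrow> ('g, 'm) monoid_scheme \<Rightarrow> 'g topology \<Rightarrow> bool" where
  "pro_p_group p G T \<longleftrightarrow>
     profinite_group G T \<and>
     (\<forall>N. N \<lhd> G \<and> openin T N \<longrightarrow> (\<exists>k. order (G Mod N) = p ^ k))"

text \<open>An \<open>n\<close>-tuple of group elements is an extensional function on \<open>{..<n}\<close>; thus the entries
  \<open>g\<^sub>1, \<dots>, g\<^sub>n\<close> are \<open>g 0, \<dots>, g (n - 1)\<close>.\<close>

abbreviation power_topology :: "'g topology \<Rightarrow> nat \<Rightarrow> (nat \<Rightarrow> 'g) topology" where
  "power_topology T n \<equiv> product_topology (\<lambda>_. T) {..<n}"

definition cochains ::
    "('a, 'r) ring_scheme \<Rightarrow> 'g topology \<Rightarrow> nat \<Rightarrow> ('a, (nat \<Rightarrow> 'g) \<Rightarrow> 'a) module" where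
  "cochains R T n =
     (ring.func_space R (topspace (power_topology T n)))
       \<lparr>carrier := {f \<in> extensional (topspace (power_topology T n)).
          continuous_map (power_topology T n) (discrete_topology (carrier R)) f}\<rparr>"

text \<open>The tuple \<open>(g\<^sub>1, \<dots>, g\<^sub>i g\<^sub>i\<^sub>+\<^sub>1, \<dots>, g\<^sub>n\<^sub>+\<^sub>1)\<close>, for \<open>1 \<le> i \<le> n\<close>.\<close>

definition merge_entries ::
    "('g, 'm) monoid_scheme \<Rightarrow> nat \<Rightarrow> nat \<Rightarrow> (nat \<Rightarrow> 'g) \<Rightarrow> nat \<Rightarrow> 'g" where
  "merge_entries G n i g =
     (\<lambda>k \<in> {..<n}. if Suc k < i then g k
                    else if Suc k = i then g k \<otimes>\<^bsub>G\<^esub> g (Suc k)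
                    else g (Suc k))"

definition differential ::
    "('a, 'r) ring_scheme \<Rightarrow> ('g, 'm) monoid_scheme \<Rightarrow> 'g topology \<Rightarrow> nat \<Rightarrow>
       ((nat \<Rightarrow> 'g) \<Rightarrow> 'a) \<Rightarrow> ((nat \<Rightarrow> 'g) \<Rightarrow> 'a)" where
  "differential R G T n f =
     (\<lambda>g \<in> topspace (power_topology T (Suc n)).
        f (\<lambda>k \<in> {..<n}. g (Suc k))
        \<oplus>\<^bsub>R\<^esub> (\<Oplus>\<^bsub>R\<^esub>i \<in> {1..n}. (\<ominus>\<^bsub>R\<^esub> \<one>\<^bsub>R\<^esub>) [^]\<^bsub>R\<^esub> i \<otimes>\<^bsub>R\<^esub> f (merge_entries G n i g))
        \<oplus>\<^bsub>R\<^esub> (\<ominus>\<^bsub>R\<^esub> \<one>\<^bsub>R\<^esub>) [^]\<^bsub>R\<^esub> (Suc n) \<otimes>\<^bsub>R\<^esub> f (restrict g {..<n}))"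

definition cup ::
    "('a, 'r) ring_scheme \<Rightarrow> 'g topology \<Rightarrow> nat \<Rightarrow> nat \<Rightarrow>
       ((nat \<Rightarrow> 'g) \<Rightarrow> 'a) \<Rightarrow> ((nat \<Rightarrow> 'g) \<Rightarrow> 'a) \<Rightarrow> ((nat \<Rightarrow> 'g) \<Rightarrow> 'a)" where
  "cup R T m n a b =
     (\<lambda>g \<in> topspace (power_topology T (m + n)).
        a (restrict g {..<m}) \<otimes>\<^bsub>R\<^esub> b (\<lambda>k \<in> {..<n}. g (m + k)))"

definition cocycles ::
    "('a, 'r) ring_scheme \<Rightarrow> ('g, 'm) monoid_scheme \<Rightarrow> 'g topology \<Rightarrow> nat \<Rightarrow>
       ((nat \<Rightarrow> 'g) \<Rightarrow> 'a) set" where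
  "cocycles R G T n =
     {f \<in> carrier (cochains R T n). differential R G T n f = \<zero>\<^bsub>cochains R T (Suc n)\<^esub>}"

fun coboundaries ::
    "('a, 'r) ring_scheme \<Rightarrow> ('g, 'm) monoid_scheme \<Rightarrow> 'g topology \<Rightarrow> nat \<Rightarrow>
       ((nat \<Rightarrow> 'g) \<Rightarrow> 'a) set" where
  "coboundaries R G T 0 = {\<zero>\<^bsub>cochains R T 0\<^esub>}"
| "coboundaries R G T (Suc n) = differential R G T n ` carrier (cochains R T n)"

definition quotient_module :: "('a, 'b, 'c) module_scheme \<Rightarrow> 'b set \<Rightarrow> ('a, 'b set) module" where
  "quotient_module M N =
     \<lparr>carrier = a_rcosets\<^bsub>M\<^esub> N, monoid.mult = undefined, one = undefined,
      zero = N, add = (\<lambda>X Y. X <+>\<^bsub>M\<^esub> Y),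
      smult = (\<lambda>r X. \<Union>x \<in> X. N +>\<^bsub>M\<^esub> (r \<odot>\<^bsub>M\<^esub> x))\<rparr>"

definition cohomology ::
    "('a, 'r) ring_scheme \<Rightarrow> ('g, 'm) monoid_scheme \<Rightarrow> 'g topology \<Rightarrow> nat \<Rightarrow>
       ('a, ((nat \<Rightarrow> 'g) \<Rightarrow> 'a) set) module" where
  "cohomology R G T n =
     quotient_module ((cochains R T n)\<lparr>carrier := cocycles R G T n\<rparr>) (coboundaries R G T n)"

definition cohomology_class ::
    "('a, 'r) ring_scheme \<Rightarrow> ('g, 'm) monoid_scheme \<Rightarrow> 'g topology \<Rightarrow> nat \<Rightarrow>
       ((nat \<Rightarrow> 'g) \<Rightarrow> 'a) \<Rightarrow> ((nat \<Rightarrow> 'g) \<Rightarrow> 'a) set" where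
  "cohomology_class R G T n f = coboundaries R G T n +>\<^bsub>cochains R T n\<^esub> f"

text \<open>All pairs of representatives give the same class, so the union is that class.\<close>

definition cohomology_cup ::
    "('a, 'r) ring_scheme \<Rightarrow> ('g, 'm) monoid_scheme \<Rightarrow> 'g topology \<Rightarrow> nat \<Rightarrow> nat \<Rightarrow>
       ((nat \<Rightarrow> 'g) \<Rightarrow> 'a) set \<Rightarrow> ((nat \<Rightarrow> 'g) \<Rightarrow> 'a) set \<Rightarrow> ((nat \<Rightarrow> 'g) \<Rightarrow> 'a) set" where
  "cohomology_cup R G T m n X Y =
     (\<Union>a \<in> X. \<Union>b \<in> Y. cohomology_class R G T (m + n) (cup R T m n a b))"

abbreviation prime_field :: "nat \<Rightarrow> int ring" where
  "prime_field p \<equiv> residue_ring (int p)"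

definition cup_nondegenerate ::
    "('a, 'r) ring_scheme \<Rightarrow> ('g, 'm) monoid_scheme \<Rightarrow> 'g topology \<Rightarrow> bool" where
  "cup_nondegenerate R G T \<longleftrightarrow>
     (\<forall>X \<in> carrier (cohomology R G T 1).
        (\<forall>Y \<in> carrier (cohomology R G T 1).
           cohomology_cup R G T 1 1 X Y = \<zero>\<^bsub>cohomology R G T 2\<^esub>) \<longrightarrow>
        X = \<zero>\<^bsub>cohomology R G T 1\<^esub>) \<and>
     (\<forall>Y \<in> carrier (cohomology R G T 1).
        (\<forall>X \<in> carrier (cohomology R G T 1).
           cohomology_cup R G T 1 1 X Y = \<zero>\<^bsub>cohomology R G T 2\<^esub>) \<longrightarrow>
        Y = \<zero>\<^bsub>cohomology R G T 1\<^esub>)"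

text \<open>The constant \<open>vectorspace.dim\<close> is meaningful only for finite-dimensional spaces.\<close>

definition demushkin_group :: "nat \<Rightarrow> ('g, 'm) monoid_scheme \<Rightarrow> 'g topology \<Rightarrow> bool" where
  "demushkin_group p G T \<longleftrightarrow>
     pro_p_group p G T \<and>
     vectorspace.fin_dim (prime_field p) (cohomology (prime_field p) G T 1) \<and>
     vectorspace.fin_dim (prime_field p) (cohomology (prime_field p) G T 2) \<and>
     vectorspace.dim (prime_field p) (cohomology (prime_field p) G T 2) = 1 \<and>
     cup_nondegenerate (prime_field p) G T"

definition defining_system ::
    "('a, 'r) ring_scheme \<Rightarrow> ('g, 'm) monoid_scheme \<Rightarrow> 'g topology \<Rightarrow> nat \<Rightarrow>
       (nat \<Rightarrow> ((nat \<Rightarrow> 'g) \<Rightarrow> 'a) set) \<Rightarrow> (nat \<Rightarrow> nat \<Rightarrow> ((nat \<Rightarrow> 'g) \<Rightarrow> 'a)) \<Rightarrow> bool" where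
  "defining_system R G T n \<alpha> a \<longleftrightarrow>
     (\<forall>i j. 1 \<le> i \<and> i < j \<and> j \<le> n + 1 \<and> (i, j) \<noteq> (1, n + 1) \<longrightarrow>
        a i j \<in> carrier (cochains R T 1) \<and>
        (j = i + 1 \<longrightarrow> a i j \<in> \<alpha> i) \<and>
        (j > i + 1 \<longrightarrow>
           differential R G T 1 (a i j) =
             (\<Oplus>\<^bsub>cochains R T 2\<^esub>l \<in> {i+1..j-1}. cup R T 1 1 (a i l) (a l j))))"

definition massey_value ::
    "('a, 'r) ring_scheme \<Rightarrow> ('g, 'm) monoid_scheme \<Rightarrow> 'g topology \<Rightarrow> nat \<Rightarrow>
       (nat \<Rightarrow> nat \<Rightarrow> ((nat \<Rightarrow> 'g) \<Rightarrow> 'a)) \<Rightarrow> ((nat \<Rightarrow> 'g) \<Rightarrow> 'a) set" where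
  "massey_value R G T n a =
     cohomology_class R G T 2
       (\<Oplus>\<^bsub>cochains R T 2\<^esub>k \<in> {2..n}. cup R T 1 1 (a 1 k) (a k (n + 1)))"

definition massey_product ::
    "('a, 'r) ring_scheme \<Rightarrow> ('g, 'm) monoid_scheme \<Rightarrow> 'g topology \<Rightarrow> nat \<Rightarrow>
       (nat \<Rightarrow> ((nat \<Rightarrow> 'g) \<Rightarrow> 'a) set) \<Rightarrow> ((nat \<Rightarrow> 'g) \<Rightarrow> 'a) set set" where
  "massey_product R G T n \<alpha> = {massey_value R G T n a | a. defining_system R G T n \<alpha> a}"

definition vanishing_massey ::
    "('a, 'r) ring_scheme \<Rightarrow> ('g, 'm) monoid_scheme \<Rightarrow> 'g topology \<Rightarrow> nat \<Rightarrow> bool" where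
  "vanishing_massey R G T n \<longleftrightarrow>
     (\<forall>\<alpha>. (\<forall>i \<in> {1..n}. \<alpha> i \<in> carrier (cohomology R G T 1)) \<longrightarrow>
        massey_product R G T n \<alpha> \<noteq> {} \<longrightarrow>
        \<zero>\<^bsub>cohomology R G T 2\<^esub> \<in> massey_product R G T n \<alpha>)"

end

theory Submission
  imports Defs
begin

text \<open>
  Since \<open>H\<^sup>2\<close> is one-dimensional and the cup product is non-degenerate, \<open>\<alpha>\<^sub>1 \<union> H\<^sup>1\<close> is all of \<open>H\<^sup>2\<close> as
  soon as \<open>\<alpha>\<^sub>1 \<noteq> 0\<close>. For \<open>n \<ge> 3\<close> the entry \<open>a\<^sub>2\<^sub>,\<^sub>n\<^sub>+\<^sub>1\<close> of a defining system occurs in no condition on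
  another entry, so adding a cocycle \<open>h\<close> to it yields another defining system, whose value differs by
  \<open>\<alpha>\<^sub>1 \<union> h\<close>; a suitable \<open>h\<close> makes the value zero. If \<open>\<alpha>\<^sub>1 = 0\<close>, its only representative is the zero
  cochain, because the action is trivial and hence nonzero coboundaries do not exist in degree one;
  then the whole first row may be replaced by zero, and the value becomes zero.
\<close>

section \<open>Quotient modules and triangular sums\<close>

text \<open>Closure under negation comes from multiplication by the scalar
  \<open>\<ominus> \<one>\<close>; the coset calculus of abelian subgroups then applies to
  submodules.\<close>

lemma (in module) abelian_subgroup_submodule:
  assumes "submodule R N M"
  shows "abelian_subgroup N M"
proof -
  interpret N: submodule R N M by fact
  have "subgroup N (add_monoid M)"
  proof
    show "N \<subseteq> carrier (add_monoid M)" using N.subset by simp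
    fix x assume x: "x \<in> N"
    then have "(\<ominus> \<one>) \<odot>\<^bsub>M\<^esub> x \<in> N" by simp
    with x N.subset show "inv\<^bsub>add_monoid M\<^esub> x \<in> N"
      by (metis a_inv_def smult_minus_1 subsetD)
  qed auto
  then show ?thesis
    using M.a_comm_group by (intro abelian_subgroupI2)
qed

text \<open>\<open>quotient_module\<close> forms a union over all representatives. Two
  representatives differ by an element of \<open>N\<close>, hence so do their multiples by
  \<open>r\<close>, and all cosets in the union coincide.\<close>

lemma (in module) quotient_smult:
  assumes "submodule R N M" "r \<in> carrier R" "x \<in> carrier M"
  shows "r \<odot>\<^bsub>quotient_module M N\<^esub> (N +>\<^bsub>M\<^esub> x) = N +>\<^bsub>M\<^esub> (r \<odot>\<^bsub>M\<^esub> x)"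
proof -
  interpret N: submodule R N M by fact
  interpret A: abelian_subgroup N M by (rule abelian_subgroup_submodule) fact
  have "N +>\<^bsub>M\<^esub> (r \<odot>\<^bsub>M\<^esub> y) = N +>\<^bsub>M\<^esub> (r \<odot>\<^bsub>M\<^esub> x)" if "y \<in> N +>\<^bsub>M\<^esub> x" for y
  proof -
    from that obtain h where h: "h \<in> N" "y = h \<oplus>\<^bsub>M\<^esub> x"
      by (auto simp: a_r_coset_def')
    then have "r \<odot>\<^bsub>M\<^esub> y = r \<odot>\<^bsub>M\<^esub> h \<oplus>\<^bsub>M\<^esub> r \<odot>\<^bsub>M\<^esub> x"
      using assms N.subset by (auto simp: smult_r_distr)
    moreover have "r \<odot>\<^bsub>M\<^esub> h \<in> N" using h assms by simp
    ultimately have "r \<odot>\<^bsub>M\<^esub> y \<in> N +>\<^bsub>M\<^esub> (r \<odot>\<^bsub>M\<^esub> x)"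
      by (auto simp: a_r_coset_def')
    then show ?thesis
      using A.a_subgroup assms by (metis M.a_repr_independence smult_closed)
  qed
  moreover have "x \<in> N +>\<^bsub>M\<^esub> x" using A.a_rcos_self assms by simp
  ultimately have "(\<Union>y \<in> N +>\<^bsub>M\<^esub> x. N +>\<^bsub>M\<^esub> (r \<odot>\<^bsub>M\<^esub> y)) = N +>\<^bsub>M\<^esub> (r \<odot>\<^bsub>M\<^esub> x)"
    by blast
  then show ?thesis
    by (simp add: quotient_module_def)
qed

text \<open>Once every operation is expressed on representatives, each axiom is inherited from
  \<open>M\<close>.\<close>

lemma (in module) quotient_module_is_module:
  assumes "submodule R N M"
  shows "module R (quotient_module M N)"
proof -
  interpret N: submodule R N M by fact
  interpret A: abelian_subgroup N M by (rule abelian_subgroup_submodule) fact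
  let ?Q = "quotient_module M N"
  have closed [simp]: "N +>\<^bsub>M\<^esub> x \<in> carrier ?Q" if "x \<in> carrier M" for x
    using that by (auto simp: quotient_module_def A_RCOSETS_def')
  have coset: thesis if "X \<in> carrier ?Q" "\<And>x. x \<in> carrier M \<Longrightarrow> X = N +>\<^bsub>M\<^esub> x \<Longrightarrow> thesis" for X thesis
    using that by (auto simp: quotient_module_def A_RCOSETS_def')
  have add [simp]: "(N +>\<^bsub>M\<^esub> x) \<oplus>\<^bsub>?Q\<^esub> (N +>\<^bsub>M\<^esub> y) = N +>\<^bsub>M\<^esub> (x \<oplus>\<^bsub>M\<^esub> y)"
    if "x \<in> carrier M" "y \<in> carrier M" for x y
    using that A.a_rcos_sum by (simp add: quotient_module_def)
  \<comment> \<open>\<open>N\<close> is written as the coset of zero so that the rule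
    \<open>add\<close> also covers the neutral element.\<close>
  have zero: "\<zero>\<^bsub>?Q\<^esub> = N +>\<^bsub>M\<^esub> \<zero>\<^bsub>M\<^esub>"
    using N.subset by (simp add: quotient_module_def)
  note smult [simp] = quotient_smult[OF assms]
  have ag: "abelian_group ?Q"
  proof (rule abelian_groupI)
    fix X assume X: "X \<in> carrier ?Q"
    then obtain x where x: "x \<in> carrier M" "X = N +>\<^bsub>M\<^esub> x" by (rule coset)
    show "\<zero>\<^bsub>?Q\<^esub> \<oplus>\<^bsub>?Q\<^esub> X = X"
      using x by (simp add: zero)
    have "(N +>\<^bsub>M\<^esub> (\<ominus>\<^bsub>M\<^esub> x)) \<oplus>\<^bsub>?Q\<^esub> X = \<zero>\<^bsub>?Q\<^esub>"
      using x by (simp add: zero M.l_neg)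
    then show "\<exists>Y\<in>carrier ?Q. Y \<oplus>\<^bsub>?Q\<^esub> X = \<zero>\<^bsub>?Q\<^esub>"
      using x by (meson M.a_inv_closed closed)
    fix Y assume "Y \<in> carrier ?Q"
    then obtain y where y: "y \<in> carrier M" "Y = N +>\<^bsub>M\<^esub> y" by (rule coset)
    show "X \<oplus>\<^bsub>?Q\<^esub> Y \<in> carrier ?Q"
      using x y by simp
    show "X \<oplus>\<^bsub>?Q\<^esub> Y = Y \<oplus>\<^bsub>?Q\<^esub> X"
      using x y by (simp add: M.a_comm)
    fix Z assume "Z \<in> carrier ?Q"
    then obtain z where "z \<in> carrier M" "Z = N +>\<^bsub>M\<^esub> z" by (rule coset)
    then show "X \<oplus>\<^bsub>?Q\<^esub> Y \<oplus>\<^bsub>?Q\<^esub> Z = X \<oplus>\<^bsub>?Q\<^esub> (Y \<oplus>\<^bsub>?Q\<^esub> Z)"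
      using x y by (simp add: M.a_assoc)
  qed (simp add: zero)
  show ?thesis
  proof (rule moduleI[OF R.is_cring ag])
    fix r X assume r: "r \<in> carrier R" and "X \<in> carrier ?Q"
    then obtain x where x: "x \<in> carrier M" "X = N +>\<^bsub>M\<^esub> x" by (blast elim: coset)
    show "r \<odot>\<^bsub>?Q\<^esub> X \<in> carrier ?Q"
      using r x by simp
    show "(r \<oplus> s) \<odot>\<^bsub>?Q\<^esub> X = r \<odot>\<^bsub>?Q\<^esub> X \<oplus>\<^bsub>?Q\<^esub> s \<odot>\<^bsub>?Q\<^esub> X" if "s \<in> carrier R" for s
      using that r x by (simp add: smult_l_distr)
    show "(r \<otimes> s) \<odot>\<^bsub>?Q\<^esub> X = r \<odot>\<^bsub>?Q\<^esub> (s \<odot>\<^bsub>?Q\<^esub> X)" if "s \<in> carrier R" for s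
      using that r x by (simp add: smult_assoc1)
    fix Y assume "Y \<in> carrier ?Q"
    then obtain y where "y \<in> carrier M" "Y = N +>\<^bsub>M\<^esub> y" by (rule coset)
    then show "r \<odot>\<^bsub>?Q\<^esub> (X \<oplus>\<^bsub>?Q\<^esub> Y) = r \<odot>\<^bsub>?Q\<^esub> X \<oplus>\<^bsub>?Q\<^esub> r \<odot>\<^bsub>?Q\<^esub> Y"
      using r x by (simp add: smult_r_distr)
  next
    fix X assume "X \<in> carrier ?Q"
    then obtain x where "x \<in> carrier M" "X = N +>\<^bsub>M\<^esub> x" by (rule coset)
    then show "\<one> \<odot>\<^bsub>?Q\<^esub> X = X"
      by simp
  qed
qed

text \<open>In dimension one a nonzero vector is a basis by itself.\<close>

lemma (in vectorspace) dim_1_scalar_multiple: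
  assumes "fin_dim" "dim = 1" "v \<in> carrier V" "v \<noteq> \<zero>\<^bsub>V\<^esub>" "w \<in> carrier V"
  obtains r where "r \<in> carrier K" "w = r \<odot>\<^bsub>V\<^esub> v"
proof -
  \<comment> \<open>The empty set is independent and spans only zero; adjoining \<open>v\<close>,
    which lies outside that span, keeps independence.\<close>
  have "lin_indpt {v}"
    using assms by (metis empty_iff empty_subsetI finite.emptyI finite_lin_indpt2 insert_iff
      insert_subset insert_union lin_dep_iff_in_span span_empty)
  then have "basis {v}"
    using assms by (intro dim_li_is_basis) auto
  then have "w \<in> span {v}"
    using assms by (simp add: basis_def)
  then obtain a where "a \<in> {v} \<rightarrow> carrier K" "w = lincomb a {v}"
    using finite_in_span[of "{v}" w] assms by auto
  then show thesis
    using that[of "a v"] assms by (auto simp: lincomb_def)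
qed

text \<open>Both sides sum \<open>F l m\<close> over \<open>k \<le> l < m \<le> n\<close>. The bound
  \<open>k > 0\<close> excludes \<open>m = 0\<close>, where the truncated \<open>m - 1\<close> would
  admit the pair \<open>l = m = 0\<close>.\<close>

lemma (in abelian_monoid) finsum_triangle_swap:
  assumes "k > 0" and "\<And>l m. F l m \<in> carrier G"
  shows "(\<Oplus>m\<in>{k..n}. \<Oplus>l\<in>{k..m-1}. F l m) = (\<Oplus>l\<in>{k..n::nat}. \<Oplus>m\<in>{l+1..n}. F l m)"
proof (induction n)
  case 0
  then show ?case using assms by simp
next
  case (Suc n)
  show ?case
  proof (cases "k \<le> Suc n")
    case True
    have S: "{k..Suc n} = insert (Suc n) {k..n}" using True by auto
    \<comment> \<open>The row \<open>l = Suc n\<close> is empty. Every other row gains one entry in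
      the new column \<open>m = Suc n\<close>; together these entries are the new outer summand on
      the other side.\<close>
    have "(\<Oplus>l\<in>{k..Suc n}. \<Oplus>m\<in>{l+1..Suc n}. F l m) = (\<Oplus>l\<in>{k..n}. \<Oplus>m\<in>{l+1..Suc n}. F l m)"
      unfolding S using assms by (subst finsum_insert) auto
    also have "\<dots> = (\<Oplus>l\<in>{k..n}. F l (Suc n) \<oplus> (\<Oplus>m\<in>{l+1..n}. F l m))"
    proof (rule finsum_cong')
      fix l assume "l \<in> {k..n}"
      then have "{l+1..Suc n} = insert (Suc n) {l+1..n}" by auto
      then show "(\<Oplus>m\<in>{l+1..Suc n}. F l m) = F l (Suc n) \<oplus> (\<Oplus>m\<in>{l+1..n}. F l m)"
        using assms by (simp add: finsum_insert)
    qed (use assms in auto)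
    also have "\<dots> = (\<Oplus>l\<in>{k..n}. F l (Suc n)) \<oplus> (\<Oplus>l\<in>{k..n}. \<Oplus>m\<in>{l+1..n}. F l m)"
      using assms by (intro finsum_addf) auto
    also have "\<dots> = (\<Oplus>m\<in>{k..Suc n}. \<Oplus>l\<in>{k..m-1}. F l m)"
      unfolding S Suc.IH[symmetric] using assms by (subst finsum_insert) auto
    finally show ?thesis by simp
  qed simp
qed

section \<open>Continuous cochains\<close>

text \<open>A product of two discrete spaces is discrete, so every binary operation on the values is
  continuous.\<close>

lemma continuous_map_discrete_binop:
  assumes "continuous_map X (discrete_topology U) f" "continuous_map X (discrete_topology U) g"
    and "\<And>x y. x \<in> U \<Longrightarrow> y \<in> U \<Longrightarrow> h x y \<in> U"
  shows "continuous_map X (discrete_topology U) (\<lambda>x. h (f x) (g x))"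
proof -
  have pair: "continuous_map X (discrete_topology (U \<times> U)) (\<lambda>x. (f x, g x))"
    using assms(1,2) by (simp add: continuous_map_paired prod_topology_discrete_topology)
  have "continuous_map (discrete_topology (U \<times> U)) (discrete_topology U) (\<lambda>(x, y). h x y)"
    using assms(3) by auto
  from continuous_map_compose[OF pair this] show ?thesis
    by (simp add: o_def)
qed

text \<open>List notation for extensional tuples: arguments of degrees 1, 2 and 3 become explicit,
  and the front and back parts of a tuple become \<open>take\<close> and
  \<open>drop\<close>.\<close>

definition tuple :: "'g list \<Rightarrow> nat \<Rightarrow> 'g" where
  "tuple xs = (\<lambda>k \<in> {..<length xs}. xs ! k)"

lemma restrict_tuple: "m \<le> length xs \<Longrightarrow> restrict (tuple xs) {..<m} = tuple (take m xs)"
  by (auto simp: tuple_def fun_eq_iff)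

lemma shift_tuple: "length xs = m + n \<Longrightarrow> (\<lambda>k \<in> {..<n}. tuple xs (m + k)) = tuple (drop m xs)"
  by (auto simp: tuple_def fun_eq_iff)

locale cochain_complex = cring R for R :: "('a, 'r) ring_scheme" (structure) +
  fixes G :: "('g, 'm) monoid_scheme" and T :: "'g topology"
  assumes topological_group: "topological_group G T"
begin

abbreviation C :: "nat \<Rightarrow> ('a, (nat \<Rightarrow> 'g) \<Rightarrow> 'a) module" where
  "C n \<equiv> cochains R T n"

abbreviation d :: "nat \<Rightarrow> ((nat \<Rightarrow> 'g) \<Rightarrow> 'a) \<Rightarrow> ((nat \<Rightarrow> 'g) \<Rightarrow> 'a)" where
  "d n \<equiv> differential R G T n"

abbreviation tuples :: "nat \<Rightarrow> (nat \<Rightarrow> 'g) set" where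
  "tuples n \<equiv> topspace (power_topology T n)"

sublocale G: group G
  using topological_group by (simp add: topological_group_def)

lemma topspace_T [simp]: "topspace T = carrier G"
  using topological_group by (simp add: topological_group_def)

lemma continuous_mult:
  assumes "continuous_map X T a" "continuous_map X T b"
  shows "continuous_map X T (\<lambda>x. a x \<otimes>\<^bsub>G\<^esub> b x)"
proof -
  have "continuous_map X (prod_topology T T) (\<lambda>x. (a x, b x))"
    using assms by (simp add: continuous_map_paired)
  moreover have "continuous_map (prod_topology T T) T (\<lambda>(x, y). x \<otimes>\<^bsub>G\<^esub> y)"
    using topological_group by (simp add: topological_group_def)
  ultimately show ?thesis
    by (auto dest: continuous_map_compose simp: o_def)
qed

section \<open>Cochains as a module of functions\<close>

lemma carrier_cochains:
  "carrier (C n) = {f \<in> extensional (tuples n).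
     continuous_map (power_topology T n) (discrete_topology (carrier R)) f}"
  by (simp add: cochains_def)

lemma cochains_simps:
  "\<zero>\<^bsub>C n\<^esub> = (\<lambda>v\<in>tuples n. \<zero>)"
  "f \<oplus>\<^bsub>C n\<^esub> g = (\<lambda>v\<in>tuples n. f v \<oplus> g v)"
  "c \<odot>\<^bsub>C n\<^esub> f = (\<lambda>v\<in>tuples n. c \<otimes> f v)"
  by (simp_all add: cochains_def func_space_def)

lemma cochain_closed: "f \<in> carrier (C n) \<Longrightarrow> g \<in> tuples n \<Longrightarrow> f g \<in> carrier R"
  by (auto simp: carrier_cochains continuous_map_def Pi_iff)

lemma restrict_in_cochains:
  assumes "continuous_map (power_topology T n) (discrete_topology (carrier R)) f"
  shows "restrict f (tuples n) \<in> carrier (C n)"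
  using assms unfolding carrier_cochains by (auto intro: continuous_map_eq)

lemma cochains_eqI:
  assumes "f \<in> extensional (tuples n)" "g \<in> extensional (tuples n)"
    "\<And>v. v \<in> tuples n \<Longrightarrow> f v = g v"
  shows "f = g"
  using assms by (rule extensionalityI)

lemma cochain_extensional: "f \<in> carrier (C n) \<Longrightarrow> f \<in> extensional (tuples n)"
  by (simp add: carrier_cochains)

text \<open>The continuous extensional functions form a submodule of all functions: discreteness of
  the coefficients makes pointwise sums and multiples continuous.\<close>

lemma cochains_module: "module R (C n)"
proof -
  interpret F: module R "func_space (tuples n)" by (rule func_space_is_module)
  have "submodule R (carrier (C n)) (func_space (tuples n))"
  proof (rule submodule.intro)
    show "module R (func_space (tuples n))" by (rule func_space_is_module)
    show "carrier (C n) \<subseteq> carrier (func_space (tuples n))"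
      using cochain_closed cochain_extensional by (fastforce simp: func_space_def PiE_def)
    show "v \<oplus>\<^bsub>func_space (tuples n)\<^esub> w \<in> carrier (C n)"
      if "v \<in> carrier (C n)" "w \<in> carrier (C n)" for v w
    proof -
      have "continuous_map (power_topology T n) (discrete_topology (carrier R)) (\<lambda>g. v g \<oplus> w g)"
        by (rule continuous_map_discrete_binop[where h="(\<oplus>)"]) (use that in \<open>auto simp: carrier_cochains\<close>)
      then show ?thesis
        using restrict_in_cochains by (simp add: func_space_def)
    qed
    have "continuous_map (power_topology T n) (discrete_topology (carrier R)) (\<lambda>g. \<zero>)"
      by simp
    then show "\<zero>\<^bsub>func_space (tuples n)\<^esub> \<in> carrier (C n)"
      using restrict_in_cochains by (simp add: func_space_def)
    show "c \<odot>\<^bsub>func_space (tuples n)\<^esub> v \<in> carrier (C n)"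
      if "c \<in> carrier R" "v \<in> carrier (C n)" for c v
    proof -
      have "continuous_map (power_topology T n) (discrete_topology (carrier R)) (\<lambda>g. c \<otimes> v g)"
        by (rule continuous_map_discrete_binop[where h="(\<otimes>)"]) (use that in \<open>auto simp: carrier_cochains\<close>)
      then show ?thesis
        using restrict_in_cochains by (simp add: func_space_def)
    qed
  qed
  then have "module R (func_space (tuples n)\<lparr>carrier := carrier (C n)\<rparr>)"
    by (rule F.submodule_is_module)
  then show ?thesis
    by (simp add: cochains_def)
qed

sublocale C: module R "C n" for n
  by (rule cochains_module)

lemma finsum_cochains_apply:
  assumes "finite A" "F \<in> A \<rightarrow> carrier (C n)" "g \<in> tuples n"
  shows "(\<Oplus>\<^bsub>C n\<^esub>i\<in>A. F i) g = (\<Oplus>i\<in>A. F i g)"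
  using assms(1,2)
proof (induction A rule: finite_induct)
  case empty
  then show ?case using assms(3) by (simp add: cochains_simps)
next
  case (insert i A)
  then have "F i \<in> carrier (C n)" "F \<in> A \<rightarrow> carrier (C n)" by auto
  moreover from this have "F i g \<in> carrier R" "(\<lambda>i. F i g) \<in> A \<rightarrow> carrier R"
    using assms(3) cochain_closed by (auto simp: Pi_iff)
  ultimately show ?case
    using insert assms(3) by (simp add: cochains_simps(2))
qed

section \<open>Continuity of the face maps, and the differential as a linear map\<close>

lemma continuous_into_power:
  assumes "\<And>k. k < n \<Longrightarrow> continuous_map X T (h k)"
  shows "continuous_map X (power_topology T n) (\<lambda>x. \<lambda>k\<in>{..<n}. h k x)"
proof -
  have "continuous_map X T (\<lambda>x. (\<lambda>k\<in>{..<n}. h k x) k)" if "k \<in> {..<n}" for k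
    using assms[of k] that by (simp only: restrict_apply' lessThan_iff)
  moreover have "(\<lambda>x. \<lambda>k\<in>{..<n}. h k x) ` topspace X \<subseteq> extensional {..<n}"
    by (rule image_subsetI) (rule restrict_extensional)
  ultimately show ?thesis
    unfolding continuous_map_componentwise by blast
qed

lemma continuous_projection:
  "k < n \<Longrightarrow> continuous_map (power_topology T n) T (\<lambda>g. g k)"
  using continuous_map_product_projection[of k "{..<n}" "\<lambda>_. T"] by simp

lemma continuous_shift:
  "continuous_map (power_topology T (Suc n)) (power_topology T n) (\<lambda>g. \<lambda>k\<in>{..<n}. g (Suc k))"
  by (intro continuous_into_power continuous_projection) simp

lemma continuous_restrict:
  assumes "m \<le> n"
  shows "continuous_map (power_topology T n) (power_topology T m) (\<lambda>g. restrict g {..<m})"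
  using assms by (intro continuous_into_power continuous_projection) simp

lemma continuous_merge_entries:
  "continuous_map (power_topology T (Suc n)) (power_topology T n) (merge_entries G n i)"
proof -
  have "continuous_map (power_topology T (Suc n)) T
      (\<lambda>g. if Suc k < i then g k else if Suc k = i then g k \<otimes>\<^bsub>G\<^esub> g (Suc k) else g (Suc k))"
    if "k < n" for k
  proof -
    have "continuous_map (power_topology T (Suc n)) T (\<lambda>g. g k)"
      "continuous_map (power_topology T (Suc n)) T (\<lambda>g. g (Suc k))"
      using that by (auto intro: continuous_projection)
    \<comment> \<open>The choice among the three branches depends on \<open>k\<close> and
      \<open>i\<close> only, so for fixed \<open>k\<close> a single branch applies to all
      \<open>g\<close>.\<close>
    with continuous_mult[OF this] show ?thesis
      by auto
  qed
  then show ?thesis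
    unfolding merge_entries_def by (rule continuous_into_power)
qed

text \<open>Read off from continuity, since a continuous map sends one underlying space into the
  other.\<close>

lemma differential_args_closed:
  assumes "v \<in> tuples (Suc n)"
  shows "(\<lambda>k\<in>{..<n}. v (Suc k)) \<in> tuples n" "restrict v {..<n} \<in> tuples n"
    "merge_entries G n i v \<in> tuples n"
proof -
  show "(\<lambda>k\<in>{..<n}. v (Suc k)) \<in> tuples n"
    by (rule funcset_mem[OF continuous_map_funspace[OF continuous_shift] assms])
  show "restrict v {..<n} \<in> tuples n"
    by (rule funcset_mem[OF continuous_map_funspace[OF continuous_restrict] assms]) simp
  show "merge_entries G n i v \<in> tuples n"
    by (rule funcset_mem[OF continuous_map_funspace[OF continuous_merge_entries] assms])
qed

lemma continuous_finsum:
  assumes "finite A" "\<forall>i\<in>A. continuous_map X (discrete_topology (carrier R)) (F i)"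
  shows "continuous_map X (discrete_topology (carrier R)) (\<lambda>x. \<Oplus>i\<in>A. F i x)"
  using assms
proof (induction A rule: finite_induct)
  case empty
  have "continuous_map X (discrete_topology (carrier R)) (\<lambda>x. \<zero>)" by simp
  then show ?case by (simp only: finsum_empty)
next
  case (insert j A)
  then have cont: "continuous_map X (discrete_topology (carrier R)) (F j)"
      "continuous_map X (discrete_topology (carrier R)) (\<lambda>x. \<Oplus>i\<in>A. F i x)"
    by blast+
  have "continuous_map X (discrete_topology (carrier R)) (\<lambda>x. F j x \<oplus> (\<Oplus>i\<in>A. F i x))"
    by (rule continuous_map_discrete_binop[where h="(\<oplus>)", OF cont]) simp
  \<comment> \<open>The summands are known to lie in \<open>R\<close> only at points of the space,
    so the sum is split only there; agreement on the space is enough for continuity.\<close>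
  moreover have "F j x \<oplus> (\<Oplus>i\<in>A. F i x) = (\<Oplus>i\<in>insert j A. F i x)" if "x \<in> topspace X" for x
  proof -
    have "F i x \<in> carrier R" if "i \<in> insert j A" for i
      using insert.prems that \<open>x \<in> topspace X\<close> by (auto simp: continuous_map_def Pi_iff)
    then show ?thesis
      using insert by (subst finsum_insert) auto
  qed
  ultimately show ?case
    by (rule continuous_map_eq)
qed

lemma cochain_compose:
  assumes "f \<in> carrier (C n)" "continuous_map X (power_topology T n) h"
  shows "continuous_map X (discrete_topology (carrier R)) (\<lambda>x. f (h x))"
proof -
  have "continuous_map (power_topology T n) (discrete_topology (carrier R)) f"
    using assms(1) by (simp add: carrier_cochains)
  from continuous_map_compose[OF assms(2) this] show ?thesis
    by (simp only: o_def)
qed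

text \<open>Each term is \<open>f\<close> after a continuous face map; signs and sums are operations
  on the discrete ring and preserve continuity.\<close>

lemma differential_closed:
  assumes f: "f \<in> carrier (C n)"
  shows "d n f \<in> carrier (C (Suc n))"
proof -
  let ?cont = "continuous_map (power_topology T (Suc n)) (discrete_topology (carrier R))"
  have scaled: "?cont (\<lambda>g. (\<ominus> \<one>) [^] (k::nat) \<otimes> h g)" if "?cont h" for h k
    by (rule continuous_map_discrete_binop[where h="(\<otimes>)"]) (use that in auto)
  have merge: "?cont (\<lambda>g. f (merge_entries G n i g))" for i
    by (rule cochain_compose[OF f continuous_merge_entries])
  have first: "?cont (\<lambda>g. f (\<lambda>k\<in>{..<n}. g (Suc k)))"
    by (rule cochain_compose[OF f continuous_shift])
  have last: "?cont (\<lambda>g. f (restrict g {..<n}))"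
    by (rule cochain_compose[OF f continuous_restrict]) simp
  have middle: "?cont (\<lambda>g. \<Oplus>i\<in>{1..n}. (\<ominus> \<one>) [^] i \<otimes> f (merge_entries G n i g))"
    by (rule continuous_finsum) (use scaled[OF merge] in blast)+
  have "?cont (\<lambda>g. f (\<lambda>k\<in>{..<n}. g (Suc k))
      \<oplus> (\<Oplus>i\<in>{1..n}. (\<ominus> \<one>) [^] i \<otimes> f (merge_entries G n i g)))"
    by (rule continuous_map_discrete_binop[where h="(\<oplus>)", OF first middle]) auto
  then have "?cont (\<lambda>g. f (\<lambda>k\<in>{..<n}. g (Suc k))
      \<oplus> (\<Oplus>i\<in>{1..n}. (\<ominus> \<one>) [^] i \<otimes> f (merge_entries G n i g))
      \<oplus> (\<ominus> \<one>) [^] Suc n \<otimes> f (restrict g {..<n}))"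
    by (rule continuous_map_discrete_binop[where h="(\<oplus>)", OF _ scaled[OF last]]) auto
  then show ?thesis
    unfolding differential_def by (rule restrict_in_cochains)
qed

text \<open>Each summand is evaluation at a face of the tuple, hence linear in the cochain. The
  cocycles thereby become a kernel and the coboundaries an image.\<close>

lemma differential_mod_hom: "mod_hom R (C n) (C (Suc n)) (d n)"
proof -
  have "d n (f \<oplus>\<^bsub>C n\<^esub> g) = d n f \<oplus>\<^bsub>C (Suc n)\<^esub> d n g"
    if fg: "f \<in> carrier (C n)" "g \<in> carrier (C n)" for f g
  proof (rule cochains_eqI)
    fix v assume v: "v \<in> tuples (Suc n)"
    let ?s = "\<lambda>k\<in>{..<n}. v (Suc k)" and ?r = "restrict v {..<n}" and ?m = "\<lambda>i. merge_entries G n i v"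
    note t = differential_args_closed[OF v]
    have cl: "f ?s \<in> carrier R" "g ?s \<in> carrier R" "f ?r \<in> carrier R" "g ?r \<in> carrier R"
      "f (?m i) \<in> carrier R" "g (?m i) \<in> carrier R" for i
      using cochain_closed fg t by blast+
    let ?e = "\<lambda>i::nat. (\<ominus> \<one>) [^] i"
    have e: "?e i \<in> carrier R" for i by simp
    have "(\<Oplus>i\<in>{1..n}. ?e i \<otimes> (f (?m i) \<oplus> g (?m i)))
        = (\<Oplus>i\<in>{1..n}. ?e i \<otimes> f (?m i) \<oplus> ?e i \<otimes> g (?m i))"
      using cl e by (intro finsum_cong') (auto simp: r_distr)
    also have "\<dots> = (\<Oplus>i\<in>{1..n}. ?e i \<otimes> f (?m i)) \<oplus> (\<Oplus>i\<in>{1..n}. ?e i \<otimes> g (?m i))"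
      using cl e by (intro finsum_addf) auto
    finally have *: "(\<Oplus>i\<in>{1..n}. ?e i \<otimes> (f (?m i) \<oplus> g (?m i)))
      = (\<Oplus>i\<in>{1..n}. ?e i \<otimes> f (?m i)) \<oplus> (\<Oplus>i\<in>{1..n}. ?e i \<otimes> g (?m i))" .
    \<comment> \<open>The alternating sums are named so that the rearrangement below treats them as
      single ring elements.\<close>
    define x where "x = (\<Oplus>i\<in>{1..n}. ?e i \<otimes> f (?m i))"
    define y where "y = (\<Oplus>i\<in>{1..n}. ?e i \<otimes> g (?m i))"
    have xy: "x \<in> carrier R" "y \<in> carrier R"
      unfolding x_def y_def using cl e by (auto intro!: finsum_closed)
    have "d n (f \<oplus>\<^bsub>C n\<^esub> g) v = (f ?s \<oplus> g ?s) \<oplus> (x \<oplus> y) \<oplus> ?e (Suc n) \<otimes> (f ?r \<oplus> g ?r)"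
      unfolding x_def y_def *[symmetric] using v t
      by (simp only: differential_def cochains_simps restrict_apply')
    also have "\<dots> = (f ?s \<oplus> x \<oplus> ?e (Suc n) \<otimes> f ?r) \<oplus> (g ?s \<oplus> y \<oplus> ?e (Suc n) \<otimes> g ?r)"
      using cl xy e[of "Suc n"] by (simp only: r_distr a_ac a_closed m_closed)
    also have "\<dots> = (d n f \<oplus>\<^bsub>C (Suc n)\<^esub> d n g) v"
      unfolding x_def y_def using v by (simp only: differential_def cochains_simps restrict_apply')
    finally show "d n (f \<oplus>\<^bsub>C n\<^esub> g) v = (d n f \<oplus>\<^bsub>C (Suc n)\<^esub> d n g) v" .
  qed (simp_all add: differential_def cochains_simps)
  moreover have "d n (c \<odot>\<^bsub>C n\<^esub> f) = c \<odot>\<^bsub>C (Suc n)\<^esub> d n f"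
    if c: "c \<in> carrier R" and f: "f \<in> carrier (C n)" for c f
  proof (rule cochains_eqI)
    fix v assume v: "v \<in> tuples (Suc n)"
    let ?s = "\<lambda>k\<in>{..<n}. v (Suc k)" and ?r = "restrict v {..<n}" and ?m = "\<lambda>i. merge_entries G n i v"
    note t = differential_args_closed[OF v]
    have cl: "f ?s \<in> carrier R" "f ?r \<in> carrier R" "f (?m i) \<in> carrier R" for i
      using cochain_closed f t by blast+
    let ?e = "\<lambda>i::nat. (\<ominus> \<one>) [^] i"
    have e: "?e i \<in> carrier R" for i by simp
    have "(\<Oplus>i\<in>{1..n}. ?e i \<otimes> (c \<otimes> f (?m i))) = (\<Oplus>i\<in>{1..n}. c \<otimes> (?e i \<otimes> f (?m i)))"
      using cl e c by (intro finsum_cong') (auto simp: m_lcomm)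
    also have "\<dots> = c \<otimes> (\<Oplus>i\<in>{1..n}. ?e i \<otimes> f (?m i))"
      using cl e c by (intro finsum_rdistr[symmetric]) auto
    finally have *: "(\<Oplus>i\<in>{1..n}. ?e i \<otimes> (c \<otimes> f (?m i))) = c \<otimes> (\<Oplus>i\<in>{1..n}. ?e i \<otimes> f (?m i))" .
    define x where "x = (\<Oplus>i\<in>{1..n}. ?e i \<otimes> f (?m i))"
    have x: "x \<in> carrier R"
      unfolding x_def using cl e by (auto intro!: finsum_closed)
    have "d n (c \<odot>\<^bsub>C n\<^esub> f) v = c \<otimes> f ?s \<oplus> c \<otimes> x \<oplus> ?e (Suc n) \<otimes> (c \<otimes> f ?r)"
      unfolding x_def *[symmetric] using v t
      by (simp only: differential_def cochains_simps restrict_apply')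
    also have "\<dots> = c \<otimes> (f ?s \<oplus> x \<oplus> ?e (Suc n) \<otimes> f ?r)"
      using cl x c e[of "Suc n"] by (simp only: r_distr a_closed m_closed m_lcomm)
    also have "\<dots> = (c \<odot>\<^bsub>C (Suc n)\<^esub> d n f) v"
      unfolding x_def using v by (simp only: differential_def cochains_simps restrict_apply')
    finally show "d n (c \<odot>\<^bsub>C n\<^esub> f) v = (c \<odot>\<^bsub>C (Suc n)\<^esub> d n f) v" .
  qed (simp_all add: differential_def cochains_simps)
  ultimately have "d n \<in> module_hom R (C n) (C (Suc n))"
    by (auto simp: module_hom_def differential_closed)
  then show ?thesis
    by (intro mod_hom.intro mod_hom_axioms.intro cochains_module)
qed


section \<open>Low degrees\<close>

lemma tuple_in_tuples: "set xs \<subseteq> carrier G \<Longrightarrow> n = length xs \<Longrightarrow> tuple xs \<in> tuples n"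
  by (auto simp: tuple_def PiE_iff dest!: nth_mem)

lemma tuples_cases:
  assumes "v \<in> tuples n"
  obtains xs where "v = tuple xs" "length xs = n" "set xs \<subseteq> carrier G"
proof
  show "v = tuple (map v [0..<n])"
    using assms by (auto simp: tuple_def PiE_iff fun_eq_iff extensional_def)
  show "set (map v [0..<n]) \<subseteq> carrier G"
    using assms by (auto simp: PiE_iff)
qed simp

lemma tuples_2_cases:
  assumes "v \<in> tuples 2"
  obtains x y where "v = tuple [x, y]" "x \<in> carrier G" "y \<in> carrier G"
proof -
  obtain xs where "v = tuple xs" "length xs = 2" "set xs \<subseteq> carrier G"
    using assms by (rule tuples_cases)
  then show thesis
    using that by (auto simp: numeral_eq_Suc length_Suc_conv)
qed

lemma tuples_3_cases:
  assumes "v \<in> tuples 3"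
  obtains x y z where "v = tuple [x, y, z]" "x \<in> carrier G" "y \<in> carrier G" "z \<in> carrier G"
proof -
  obtain xs where "v = tuple xs" "length xs = 3" "set xs \<subseteq> carrier G"
    using assms by (rule tuples_cases)
  then show thesis
    using that by (auto simp: numeral_eq_Suc length_Suc_conv)
qed

lemma minus_one_pow:
  "(\<ominus> \<one>) [^] (1::nat) = \<ominus> \<one>" "(\<ominus> \<one>) [^] (2::nat) = \<one>" "(\<ominus> \<one>) [^] (3::nat) = \<ominus> \<one>"
  by (simp_all add: numeral_eq_Suc l_minus r_minus)

lemma merge_entries_tuple:
  "merge_entries G 1 1 (tuple [x, y]) = tuple [x \<otimes>\<^bsub>G\<^esub> y]"
  "merge_entries G 2 1 (tuple [x, y, z]) = tuple [x \<otimes>\<^bsub>G\<^esub> y, z]"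
  "merge_entries G 2 2 (tuple [x, y, z]) = tuple [x, y \<otimes>\<^bsub>G\<^esub> z]"
  by (auto simp: merge_entries_def tuple_def fun_eq_iff less_Suc_eq numeral_eq_Suc)

lemma cochain_1_closed [simp]: "a \<in> carrier (C 1) \<Longrightarrow> x \<in> carrier G \<Longrightarrow> a (tuple [x]) \<in> carrier R"
  by (rule cochain_closed[OF _ tuple_in_tuples]) simp_all

lemma cochain_2_closed [simp]:
  "f \<in> carrier (C 2) \<Longrightarrow> x \<in> carrier G \<Longrightarrow> y \<in> carrier G \<Longrightarrow> f (tuple [x, y]) \<in> carrier R"
  by (rule cochain_closed[where n=2, OF _ tuple_in_tuples]) simp_all

text \<open>The action is trivial, so no group element acts on the first summand; a 1-cocycle is
  therefore a continuous homomorphism into the additive group of \<open>R\<close>.\<close>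

lemma differential_1:
  assumes "a \<in> carrier (C 1)" "x \<in> carrier G" "y \<in> carrier G"
  shows "d 1 a (tuple [x, y]) = a (tuple [y]) \<oplus> \<ominus> a (tuple [x \<otimes>\<^bsub>G\<^esub> y]) \<oplus> a (tuple [x])"
proof -
  have v: "tuple [x, y] \<in> tuples (Suc 1)"
    using assms by (intro tuple_in_tuples) auto
  have "(\<lambda>k\<in>{..<1}. tuple [x, y] (Suc k)) = tuple [y]"
    using shift_tuple[of "[x, y]" 1 1] by simp
  moreover have "restrict (tuple [x, y]) {..<1} = tuple [x]"
    using restrict_tuple[of 1 "[x, y]"] by simp
  moreover have "(\<Oplus>i\<in>{1..1::nat}. (\<ominus> \<one>) [^] i \<otimes> a (merge_entries G 1 i (tuple [x, y])))
      = \<ominus> a (tuple [x \<otimes>\<^bsub>G\<^esub> y])"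
    using assms merge_entries_tuple(1)[of x y] by (simp add: minus_one_pow l_minus)
  moreover have "(\<ominus> \<one>) [^] Suc 1 \<otimes> a (tuple [x]) = a (tuple [x])"
    using assms minus_one_pow(2) by (simp add: numeral_2_eq_2)
  ultimately show ?thesis
    unfolding differential_def restrict_apply'[OF v] by simp
qed

lemma differential_2:
  assumes "f \<in> carrier (C 2)" "x \<in> carrier G" "y \<in> carrier G" "z \<in> carrier G"
  shows "d 2 f (tuple [x, y, z]) = f (tuple [y, z]) \<oplus> (\<ominus> f (tuple [x \<otimes>\<^bsub>G\<^esub> y, z])
    \<oplus> f (tuple [x, y \<otimes>\<^bsub>G\<^esub> z])) \<oplus> \<ominus> f (tuple [x, y])"
proof -
  have v: "tuple [x, y, z] \<in> tuples (Suc 2)"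
    using assms by (intro tuple_in_tuples) auto
  have "(\<lambda>k\<in>{..<2}. tuple [x, y, z] (Suc k)) = tuple [y, z]"
    using shift_tuple[of "[x, y, z]" 1 2] by simp
  moreover have "restrict (tuple [x, y, z]) {..<2} = tuple [x, y]"
    using restrict_tuple[of 2 "[x, y, z]"] by (simp add: numeral_2_eq_2)
  moreover have "(\<Oplus>i\<in>{1..2::nat}. (\<ominus> \<one>) [^] i \<otimes> f (merge_entries G 2 i (tuple [x, y, z])))
      = \<ominus> f (tuple [x \<otimes>\<^bsub>G\<^esub> y, z]) \<oplus> f (tuple [x, y \<otimes>\<^bsub>G\<^esub> z])"
  proof -
    have "{1..2::nat} = {1, 2}" by auto
    then show ?thesis
      using assms by (simp add: finsum_insert Pi_iff merge_entries_tuple minus_one_pow l_minus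
          del: One_nat_def)
  qed
  moreover have "(\<ominus> \<one>) [^] Suc 2 \<otimes> f (tuple [x, y]) = \<ominus> f (tuple [x, y])"
    using assms minus_one_pow(3) by (simp add: numeral_eq_Suc l_minus)
  ultimately show ?thesis
    unfolding differential_def restrict_apply'[OF v] by simp
qed

text \<open>Lists of three group elements exhaust the arguments, so the cocycle identity is tested
  on them alone.\<close>

lemma cocycle_2I:
  assumes "f \<in> carrier (C 2)"
    and "\<And>x y z. x \<in> carrier G \<Longrightarrow> y \<in> carrier G \<Longrightarrow> z \<in> carrier G \<Longrightarrow>
      f (tuple [y, z]) \<oplus> (\<ominus> f (tuple [x \<otimes>\<^bsub>G\<^esub> y, z]) \<oplus> f (tuple [x, y \<otimes>\<^bsub>G\<^esub> z])) \<oplus> \<ominus> f (tuple [x, y]) = \<zero>"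
  shows "f \<in> cocycles R G T 2"
proof -
  have "d 2 f = \<zero>\<^bsub>C (Suc 2)\<^esub>"
  proof (rule cochains_eqI)
    fix v assume v: "v \<in> tuples (Suc 2)"
    then have "v \<in> tuples 3" by (simp add: numeral_eq_Suc)
    then obtain x y z where "v = tuple [x, y, z]" "x \<in> carrier G" "y \<in> carrier G" "z \<in> carrier G"
      by (rule tuples_3_cases)
    then show "d 2 f v = \<zero>\<^bsub>C (Suc 2)\<^esub> v"
      using v assms by (simp only: differential_2 cochains_simps restrict_apply')
  qed (simp_all add: differential_def cochains_simps)
  then show ?thesis
    using assms(1) by (simp add: cocycles_def)
qed

text \<open>The values of \<open>a\<close> at \<open>x\<close>, \<open>y\<close>, \<open>z\<close>,
  \<open>xy\<close>, \<open>yz\<close> and \<open>xyz\<close> each occur twice with opposite signs;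
  associativity identifies the two forms of \<open>xyz\<close>.\<close>

lemma differential_differential_1:
  assumes "a \<in> carrier (C 1)"
  shows "d 1 a \<in> cocycles R G T 2"
proof (rule cocycle_2I)
  show C2: "d 1 a \<in> carrier (C 2)"
    using differential_closed[OF assms] by (simp add: numeral_2_eq_2)
  fix x y z assume G: "x \<in> carrier G" "y \<in> carrier G" "z \<in> carrier G"
  have cl: "a (tuple [x]) \<in> carrier R" "a (tuple [y]) \<in> carrier R" "a (tuple [z]) \<in> carrier R"
    "a (tuple [x \<otimes>\<^bsub>G\<^esub> y]) \<in> carrier R" "a (tuple [y \<otimes>\<^bsub>G\<^esub> z]) \<in> carrier R"
    "a (tuple [x \<otimes>\<^bsub>G\<^esub> (y \<otimes>\<^bsub>G\<^esub> z)]) \<in> carrier R"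
    using G assms by simp_all
  have e: "d 1 a (tuple [u, v]) = a (tuple [v]) \<oplus> \<ominus> a (tuple [u \<otimes>\<^bsub>G\<^esub> v]) \<oplus> a (tuple [u])"
    if "u \<in> carrier G" "v \<in> carrier G" for u v
    using differential_1[OF assms that] .
  have "x \<otimes>\<^bsub>G\<^esub> y \<otimes>\<^bsub>G\<^esub> z = x \<otimes>\<^bsub>G\<^esub> (y \<otimes>\<^bsub>G\<^esub> z)"
    using G by (rule G.m_assoc)
  then show "d 1 a (tuple [y, z]) \<oplus> (\<ominus> d 1 a (tuple [x \<otimes>\<^bsub>G\<^esub> y, z])
      \<oplus> d 1 a (tuple [x, y \<otimes>\<^bsub>G\<^esub> z])) \<oplus> \<ominus> d 1 a (tuple [x, y]) = \<zero>"
    unfolding e[OF G(2,3)] e[OF G.m_closed[OF G(1,2)] G(3)] e[OF G(1) G.m_closed[OF G(2,3)]] e[OF G(1,2)]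
    using cl by (simp only:) algebra
qed

section \<open>Cocycles, coboundaries and the second cohomology module\<close>

lemma submodule_cocycles: "submodule R (cocycles R G T n) (C n)"
  using mod_hom.ker_is_submodule[OF differential_mod_hom[of n]]
  by (simp add: mod_hom.ker_def[OF differential_mod_hom] cocycles_def)

lemma coboundaries_2: "coboundaries R G T 2 = d 1 ` carrier (C 1)"
  by (simp add: numeral_2_eq_2)

lemma submodule_coboundaries_2: "submodule R (coboundaries R G T 2) (C 2)"
  using mod_hom.im_is_submodule[OF differential_mod_hom[of 1]]
  by (simp add: mod_hom.im_def[OF differential_mod_hom] numeral_2_eq_2)

lemma abelian_subgroup_coboundaries_2: "abelian_subgroup (coboundaries R G T 2) (C 2)"
  by (rule C.abelian_subgroup_submodule[OF submodule_coboundaries_2])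

text \<open>\<open>cohomology\<close> takes the quotient inside the cocycles, so the coboundaries
  have to be a submodule of that smaller module.\<close>

lemma coboundaries_2_submodule_cocycles:
  "submodule R (coboundaries R G T 2) ((C 2)\<lparr>carrier := cocycles R G T 2\<rparr>)"
proof -
  interpret B: submodule R "coboundaries R G T 2" "C 2" by (rule submodule_coboundaries_2)
  have "coboundaries R G T 2 \<subseteq> cocycles R G T 2"
    unfolding coboundaries_2 using differential_differential_1 by blast
  then show ?thesis
    using C.submodule_is_module[OF submodule_cocycles[of 2]]
    by (intro submodule.intro) auto
qed

text \<open>Cosets depend only on addition, which restricting the carrier leaves alone; so
  \<open>cohomology_class\<close>, formed among all cochains, agrees with the cosets in
  \<open>cohomology\<close>.\<close>

lemma r_coset_cocycles:
  "X +>\<^bsub>(C n)\<lparr>carrier := cocycles R G T n\<rparr>\<^esub> f = X +>\<^bsub>C n\<^esub> f"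
  by (simp add: a_r_coset_def r_coset_def)

lemma cohomology_2_module: "module R (cohomology R G T 2)"
  unfolding cohomology_def
  by (rule module.quotient_module_is_module[OF C.submodule_is_module[OF submodule_cocycles]
        coboundaries_2_submodule_cocycles])

lemma carrier_cohomology:
  "carrier (cohomology R G T n) = cohomology_class R G T n ` cocycles R G T n"
  by (auto simp: cohomology_def cohomology_class_def quotient_module_def A_RCOSETS_def' r_coset_cocycles)

lemma zero_cohomology: "\<zero>\<^bsub>cohomology R G T n\<^esub> = coboundaries R G T n"
  by (simp add: cohomology_def quotient_module_def)

lemma cohomology_2_smult:
  assumes "r \<in> carrier R" "z \<in> cocycles R G T 2"
  shows "r \<odot>\<^bsub>cohomology R G T 2\<^esub> cohomology_class R G T 2 z = cohomology_class R G T 2 (r \<odot>\<^bsub>C 2\<^esub> z)"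
  using module.quotient_smult[OF C.submodule_is_module[OF submodule_cocycles]
        coboundaries_2_submodule_cocycles assms(1), of z] assms(2)
  by (simp add: cohomology_def cohomology_class_def r_coset_cocycles)

lemma cohomology_2_add:
  assumes "f \<in> cocycles R G T 2" "g \<in> cocycles R G T 2"
  shows "cohomology_class R G T 2 f \<oplus>\<^bsub>cohomology R G T 2\<^esub> cohomology_class R G T 2 g
    = cohomology_class R G T 2 (f \<oplus>\<^bsub>C 2\<^esub> g)"
proof -
  interpret B: abelian_subgroup "coboundaries R G T 2" "C 2" by (rule abelian_subgroup_coboundaries_2)
  have "f \<in> carrier (C 2)" "g \<in> carrier (C 2)"
    using assms by (simp_all add: cocycles_def)
  then show ?thesis
    using B.a_rcos_sum by (simp add: cohomology_def cohomology_class_def quotient_module_def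
        set_add_def set_mult_def)
qed

lemma cohomology_class_2_zero: "cohomology_class R G T 2 \<zero>\<^bsub>C 2\<^esub> = \<zero>\<^bsub>cohomology R G T 2\<^esub>"
  using submodule.subset[OF submodule_coboundaries_2]
  by (simp add: cohomology_class_def zero_cohomology C.M.a_coset_add_zero)

text \<open>Under the trivial action a 0-cochain yields the difference of one value with
  itself.\<close>

lemma coboundaries_1: "coboundaries R G T 1 = {\<zero>\<^bsub>C 1\<^esub>}"
proof -
  have "d 0 f = \<zero>\<^bsub>C 1\<^esub>" if "f \<in> carrier (C 0)" for f
  proof (rule cochains_eqI)
    fix v assume v: "v \<in> tuples 1"
    \<comment> \<open>The only 0-tuple is the everywhere undefined function; both outer faces equal
      it and carry opposite signs, and the middle sum is empty.\<close>
    have "tuple [] \<in> tuples 0" by (rule tuple_in_tuples) simp_all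
    then have "f (\<lambda>k. undefined) \<in> carrier R"
      using cochain_closed[OF that, of "tuple []"] by (simp add: tuple_def)
    moreover have "(\<lambda>k\<in>{}. v (Suc k)) = (\<lambda>k. undefined)" "restrict v {} = (\<lambda>k. undefined)"
      by (simp_all add: restrict_def)
    ultimately show "d 0 f v = \<zero>\<^bsub>C 1\<^esub> v"
      using v by (simp add: differential_def cochains_simps l_minus r_neg)
  qed (simp_all add: differential_def cochains_simps)
  then show ?thesis
    using C.M.zero_closed[of 0] by auto
qed

text \<open>As zero is the only coboundary in degree one, an element of H^1 has exactly one
  representing cochain.\<close>

lemma cohomology_class_1: "f \<in> carrier (C 1) \<Longrightarrow> cohomology_class R G T 1 f = {f}"
  unfolding cohomology_class_def coboundaries_1 by (auto simp: a_r_coset_def')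

section \<open>Cup products of 1-cochains\<close>

lemma cup_closed:
  assumes "a \<in> carrier (C 1)" "b \<in> carrier (C 1)"
  shows "cup R T 1 1 a b \<in> carrier (C 2)"
proof -
  have "continuous_map (power_topology T 2) (power_topology T 1) (\<lambda>g. \<lambda>k\<in>{..<1}. g (1 + k))"
    by (intro continuous_into_power continuous_projection) simp
  note b = cochain_compose[OF assms(2) this]
  have "continuous_map (power_topology T 2) (power_topology T 1) (\<lambda>g. restrict g {..<1})"
    by (rule continuous_restrict) simp
  note a = cochain_compose[OF assms(1) this]
  have "continuous_map (power_topology T 2) (discrete_topology (carrier R))
      (\<lambda>g. a (restrict g {..<1}) \<otimes> b (\<lambda>k\<in>{..<1}. g (1 + k)))"
    by (rule continuous_map_discrete_binop[where h="(\<otimes>)", OF a b]) (rule m_closed)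
  then show ?thesis
    unfolding cup_def one_add_one by (rule restrict_in_cochains)
qed

lemma cup_apply:
  assumes "x \<in> carrier G" "y \<in> carrier G"
  shows "cup R T 1 1 a b (tuple [x, y]) = a (tuple [x]) \<otimes> b (tuple [y])"
proof -
  have "tuple [x, y] \<in> tuples (1 + 1)"
    using assms by (intro tuple_in_tuples) simp_all
  moreover have "(\<lambda>k\<in>{..<1}. tuple [x, y] (1 + k)) = tuple [y]"
    using shift_tuple[of "[x, y]" 1 1] by simp
  moreover have "restrict (tuple [x, y]) {..<1} = tuple [x]"
    using restrict_tuple[of 1 "[x, y]"] by simp
  ultimately show ?thesis
    unfolding cup_def by (simp only: restrict_apply')
qed

lemma cochains_2_eqI:
  assumes "f \<in> carrier (C 2)" "g \<in> carrier (C 2)"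
    "\<And>x y. x \<in> carrier G \<Longrightarrow> y \<in> carrier G \<Longrightarrow> f (tuple [x, y]) = g (tuple [x, y])"
  shows "f = g"
  using assms(1,2)[THEN cochain_extensional]
proof (rule cochains_eqI)
  fix v assume "v \<in> tuples 2"
  then show "f v = g v"
    by (rule tuples_2_cases) (use assms(3) in blast)
qed

lemma cochains_1_apply:
  assumes "x \<in> carrier G"
  shows "\<zero>\<^bsub>C 1\<^esub> (tuple [x]) = \<zero>" "(f \<oplus>\<^bsub>C 1\<^esub> g) (tuple [x]) = f (tuple [x]) \<oplus> g (tuple [x])"
    "(c \<odot>\<^bsub>C 1\<^esub> f) (tuple [x]) = c \<otimes> f (tuple [x])"
proof -
  have "tuple [x] \<in> tuples 1" using assms by (intro tuple_in_tuples) simp_all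
  then show "\<zero>\<^bsub>C 1\<^esub> (tuple [x]) = \<zero>" "(f \<oplus>\<^bsub>C 1\<^esub> g) (tuple [x]) = f (tuple [x]) \<oplus> g (tuple [x])"
    "(c \<odot>\<^bsub>C 1\<^esub> f) (tuple [x]) = c \<otimes> f (tuple [x])"
    by (simp_all only: cochains_simps restrict_apply')
qed

lemma cochains_2_apply:
  assumes "x \<in> carrier G" "y \<in> carrier G"
  shows "\<zero>\<^bsub>C 2\<^esub> (tuple [x, y]) = \<zero>"
    "(f \<oplus>\<^bsub>C 2\<^esub> g) (tuple [x, y]) = f (tuple [x, y]) \<oplus> g (tuple [x, y])"
    "(c \<odot>\<^bsub>C 2\<^esub> f) (tuple [x, y]) = c \<otimes> f (tuple [x, y])"
proof -
  have "tuple [x, y] \<in> tuples 2" using assms by (intro tuple_in_tuples) simp_all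
  then show "\<zero>\<^bsub>C 2\<^esub> (tuple [x, y]) = \<zero>"
    "(f \<oplus>\<^bsub>C 2\<^esub> g) (tuple [x, y]) = f (tuple [x, y]) \<oplus> g (tuple [x, y])"
    "(c \<odot>\<^bsub>C 2\<^esub> f) (tuple [x, y]) = c \<otimes> f (tuple [x, y])"
    by (simp_all only: cochains_simps restrict_apply')
qed

text \<open>Serves the case of a zero first row, where every product starting in that row
  vanishes.\<close>

lemma cup_zero_left:
  assumes "b \<in> carrier (C 1)"
  shows "cup R T 1 1 \<zero>\<^bsub>C 1\<^esub> b = \<zero>\<^bsub>C 2\<^esub>"
  using assms
  by (intro cochains_2_eqI) (simp_all only: cup_closed C.M.zero_closed cup_apply cochains_1_apply
      cochains_2_apply l_null cochain_1_closed)

text \<open>Tracks how a product changes when a multiple of \<open>h\<close> is added to its right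
  factor; commutativity of \<open>R\<close> moves \<open>r\<close> past the value of
  \<open>a\<close>.\<close>

lemma cup_add_smult_right:
  assumes "a \<in> carrier (C 1)" "b \<in> carrier (C 1)" "h \<in> carrier (C 1)" "r \<in> carrier R"
  shows "cup R T 1 1 a (b \<oplus>\<^bsub>C 1\<^esub> r \<odot>\<^bsub>C 1\<^esub> h) = cup R T 1 1 a b \<oplus>\<^bsub>C 2\<^esub> r \<odot>\<^bsub>C 2\<^esub> cup R T 1 1 a h"
  using assms
  by (intro cochains_2_eqI) (simp_all only: cup_closed C.M.a_closed C.smult_closed cup_apply
      cochains_1_apply cochains_2_apply r_distr m_lcomm m_closed cochain_1_closed)

section \<open>Massey products\<close>

text \<open>In coordinates, \<open>\<partial>a\<^sub>i\<^sub>j = \<Sum> a\<^sub>i\<^sub>l \<union> a\<^sub>l\<^sub>j\<close> reads \<open>a\<^sub>i\<^sub>j(xy) + \<Sum> a\<^sub>i\<^sub>l(x) a\<^sub>l\<^sub>j(y) = a\<^sub>i\<^sub>j(x) + a\<^sub>i\<^sub>j(y)\<close>; the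
  cocycle identity holds because the triple sums arising from \<open>c(xy, z)\<close> and \<open>c(x, yz)\<close> agree.\<close>

lemma massey_sum_cocycle:
  fixes n :: nat
  assumes a: "\<And>i j. 1 \<le> i \<Longrightarrow> i < j \<Longrightarrow> j \<le> n + 1 \<Longrightarrow> (i, j) \<noteq> (1, n + 1) \<Longrightarrow> a i j \<in> carrier (C 1)"
    and da: "\<And>i j. 1 \<le> i \<Longrightarrow> i < j \<Longrightarrow> j \<le> n + 1 \<Longrightarrow> (i, j) \<noteq> (1, n + 1) \<Longrightarrow>
      d 1 (a i j) = (\<Oplus>\<^bsub>C 2\<^esub>l\<in>{i+1..j-1}. cup R T 1 1 (a i l) (a l j))"
  shows "(\<Oplus>\<^bsub>C 2\<^esub>k\<in>{2..n}. cup R T 1 1 (a 1 k) (a k (n + 1))) \<in> cocycles R G T 2"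
proof -
  \<comment> \<open>\<open>ok\<close> marks the positions of a defining system: strictly above the
    diagonal, except the corner.\<close>
  define ok where "ok i j \<longleftrightarrow> 1 \<le> i \<and> i < j \<and> j \<le> n + 1 \<and> (i, j) \<noteq> (1, n + 1)" for i j
  \<comment> \<open>Extension by zero to all indices and arguments keeps every value in
    \<open>R\<close>, so that membership conditions on sums hold unconditionally.\<close>
  define A where "A i j x = (if ok i j \<and> x \<in> carrier G then a i j (tuple [x]) else \<zero>)" for i j x
  let ?N = "n + 1"
  have acl: "a i j \<in> carrier (C 1)" if "ok i j" for i j
    using a that by (auto simp: ok_def)
  have Acl [simp]: "A i j x \<in> carrier R" for i j x
    using acl by (simp add: A_def)
  have cupA: "cup R T 1 1 (a i l) (a l j) (tuple [x, y]) = A i l x \<otimes> A l j y"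
    if "ok i l" "ok l j" "x \<in> carrier G" "y \<in> carrier G" for i l j x y
    using that by (simp add: cup_apply A_def del: One_nat_def)
  have sumA: "(\<Oplus>\<^bsub>C 2\<^esub>l\<in>L. cup R T 1 1 (a i l) (a l j)) (tuple [x, y]) = (\<Oplus>l\<in>L. A i l x \<otimes> A l j y)"
    if "finite L" "\<And>l. l \<in> L \<Longrightarrow> ok i l \<and> ok l j" "x \<in> carrier G" "y \<in> carrier G" for L i j x y
  proof -
    have "tuple [x, y] \<in> tuples 2" using that by (intro tuple_in_tuples) simp_all
    then have "(\<Oplus>\<^bsub>C 2\<^esub>l\<in>L. cup R T 1 1 (a i l) (a l j)) (tuple [x, y])
        = (\<Oplus>l\<in>L. cup R T 1 1 (a i l) (a l j) (tuple [x, y]))"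
      using that acl cup_closed by (intro finsum_cochains_apply) (blast intro: Pi_I)+
    also have "\<dots> = (\<Oplus>l\<in>L. A i l x \<otimes> A l j y)"
      using that cupA by (intro finsum_cong') auto
    finally show ?thesis .
  qed
  \<comment> \<open>Equivalently, the unipotent matrix \<open>I - A(x)\<close> is multiplicative in
    \<open>x\<close> at every position marked \<open>ok\<close>. On the first superdiagonal the sum
    is empty and the entry is additive.\<close>
  have mult: "A i j (x \<otimes>\<^bsub>G\<^esub> y) \<oplus> (\<Oplus>l\<in>{i+1..j-1}. A i l x \<otimes> A l j y) = A i j x \<oplus> A i j y"
    if "ok i j" "x \<in> carrier G" "y \<in> carrier G" for i j x y
  proof -
    have "A i j y \<oplus> \<ominus> A i j (x \<otimes>\<^bsub>G\<^esub> y) \<oplus> A i j x = d 1 (a i j) (tuple [x, y])"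
      using that acl by (simp add: differential_1 A_def del: One_nat_def)
    also have "\<dots> = (\<Oplus>\<^bsub>C 2\<^esub>l\<in>{i+1..j-1}. cup R T 1 1 (a i l) (a l j)) (tuple [x, y])"
    proof -
      have "d 1 (a i j) = (\<Oplus>\<^bsub>C 2\<^esub>l\<in>{i+1..j-1}. cup R T 1 1 (a i l) (a l j))"
        using that unfolding ok_def by (intro da) blast+
      then show ?thesis by (simp only:)
    qed
    also have "\<dots> = (\<Oplus>l\<in>{i+1..j-1}. A i l x \<otimes> A l j y)"
      using that by (intro sumA) (auto simp: ok_def)
    finally have *: "(\<Oplus>l\<in>{i+1..j-1}. A i l x \<otimes> A l j y)
      = A i j y \<oplus> \<ominus> A i j (x \<otimes>\<^bsub>G\<^esub> y) \<oplus> A i j x" ..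
    show ?thesis
      unfolding * using Acl[of i j x] Acl[of i j y] Acl[of i j "x \<otimes>\<^bsub>G\<^esub> y"] by algebra
  qed
  let ?c = "\<Oplus>\<^bsub>C 2\<^esub>k\<in>{2..n}. cup R T 1 1 (a 1 k) (a k ?N)"
  let ?s = "\<lambda>x y. \<Oplus>k\<in>{2..n}. A 1 k x \<otimes> A k ?N y"
  have c: "?c (tuple [x, y]) = ?s x y" if "x \<in> carrier G" "y \<in> carrier G" for x y
    using that by (intro sumA) (auto simp: ok_def)
  show ?thesis
  proof (rule cocycle_2I)
    show "?c \<in> carrier (C 2)"
      by (intro C.M.finsum_closed Pi_I cup_closed acl) (auto simp: ok_def)
    fix x y z assume G: "x \<in> carrier G" "y \<in> carrier G" "z \<in> carrier G"
    \<comment> \<open>\<open>?W\<close> is the triple sum by which both c(xy, z) and c(x, yz) fail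
      to be additive in the merged argument.\<close>
    let ?W = "\<Oplus>l\<in>{2..n}. \<Oplus>m\<in>{l+1..n}. A 1 l x \<otimes> A l m y \<otimes> A m ?N z"
    have Wcl: "?W \<in> carrier R" and scl: "?s u v \<in> carrier R" for u v
      by (auto intro!: finsum_closed)
    have W: "(\<Oplus>m\<in>{2..n}. (\<Oplus>l\<in>{2..m-1}. A 1 l x \<otimes> A l m y) \<otimes> A m ?N z) = ?W"
    proof -
      have "(\<Oplus>m\<in>{2..n}. (\<Oplus>l\<in>{2..m-1}. A 1 l x \<otimes> A l m y) \<otimes> A m ?N z)
          = (\<Oplus>m\<in>{2..n}. \<Oplus>l\<in>{2..m-1}. A 1 l x \<otimes> A l m y \<otimes> A m ?N z)"
        by (intro finsum_cong') (auto intro!: finsum_closed finsum_ldistr)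
      also have "\<dots> = ?W"
        by (rule finsum_triangle_swap) simp_all
      finally show ?thesis .
    qed
    \<comment> \<open>Expanding the entries \<open>A 1 m\<close> at xy by \<open>mult\<close>
      produces correction terms, which add up to \<open>?W\<close>.\<close>
    have "?s (x \<otimes>\<^bsub>G\<^esub> y) z \<oplus> ?W = (\<Oplus>m\<in>{2..n}. A 1 m (x \<otimes>\<^bsub>G\<^esub> y) \<otimes> A m ?N z
        \<oplus> (\<Oplus>l\<in>{2..m-1}. A 1 l x \<otimes> A l m y) \<otimes> A m ?N z)"
      unfolding W[symmetric] by (intro finsum_addf[symmetric]) (auto intro!: finsum_closed)
    also have "\<dots> = (\<Oplus>m\<in>{2..n}. A 1 m x \<otimes> A m ?N z \<oplus> A 1 m y \<otimes> A m ?N z)"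
    proof (intro finsum_cong')
      fix m assume "m \<in> {2..n}"
      then have "ok 1 m" by (auto simp: ok_def)
      from mult[OF this G(1,2)]
      have "(A 1 m (x \<otimes>\<^bsub>G\<^esub> y) \<oplus> (\<Oplus>l\<in>{2..m-1}. A 1 l x \<otimes> A l m y)) \<otimes> A m ?N z
        = (A 1 m x \<oplus> A 1 m y) \<otimes> A m ?N z"
        by (simp only: one_add_one)
      then show "A 1 m (x \<otimes>\<^bsub>G\<^esub> y) \<otimes> A m ?N z \<oplus> (\<Oplus>l\<in>{2..m-1}. A 1 l x \<otimes> A l m y) \<otimes> A m ?N z
        = A 1 m x \<otimes> A m ?N z \<oplus> A 1 m y \<otimes> A m ?N z"
        by (subst (asm) (1 2) l_distr) (auto intro!: finsum_closed)
    qed auto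
    also have "\<dots> = ?s x z \<oplus> ?s y z"
      by (intro finsum_addf) auto
    finally have left: "?s (x \<otimes>\<^bsub>G\<^esub> y) z \<oplus> ?W = ?s x z \<oplus> ?s y z" .
    \<comment> \<open>Here the factor at \<open>x\<close> is pulled out instead; the upper bound
      \<open>?N-1\<close> is kept in the shape in which \<open>mult\<close> delivers it for column
      \<open>?N\<close>.\<close>
    have W': "?W = (\<Oplus>l\<in>{2..n}. A 1 l x \<otimes> (\<Oplus>m\<in>{l+1..?N-1}. A l m y \<otimes> A m ?N z))"
    proof (intro finsum_cong')
      fix l assume "l \<in> {2..n}"
      have "A 1 l x \<otimes> (\<Oplus>m\<in>{l+1..?N-1}. A l m y \<otimes> A m ?N z)
          = (\<Oplus>m\<in>{l+1..?N-1}. A 1 l x \<otimes> (A l m y \<otimes> A m ?N z))"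
        by (intro finsum_rdistr) auto
      then show "(\<Oplus>m\<in>{l+1..n}. A 1 l x \<otimes> A l m y \<otimes> A m ?N z)
          = A 1 l x \<otimes> (\<Oplus>m\<in>{l+1..?N-1}. A l m y \<otimes> A m ?N z)"
        by (simp add: m_assoc)
    qed (auto intro!: finsum_closed)
    have "?s x (y \<otimes>\<^bsub>G\<^esub> z) \<oplus> ?W = (\<Oplus>l\<in>{2..n}. A 1 l x \<otimes> A l ?N (y \<otimes>\<^bsub>G\<^esub> z)
        \<oplus> A 1 l x \<otimes> (\<Oplus>m\<in>{l+1..?N-1}. A l m y \<otimes> A m ?N z))"
      unfolding W' by (intro finsum_addf[symmetric]) (auto intro!: finsum_closed)
    also have "\<dots> = (\<Oplus>l\<in>{2..n}. A 1 l x \<otimes> A l ?N y \<oplus> A 1 l x \<otimes> A l ?N z)"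
    proof (intro finsum_cong')
      fix l assume "l \<in> {2..n}"
      then have "ok l ?N" by (auto simp: ok_def)
      from mult[OF this G(2,3)]
      have "A 1 l x \<otimes> (A l ?N (y \<otimes>\<^bsub>G\<^esub> z) \<oplus> (\<Oplus>m\<in>{l+1..?N-1}. A l m y \<otimes> A m ?N z))
        = A 1 l x \<otimes> (A l ?N y \<oplus> A l ?N z)"
        by (simp only:)
      then show "A 1 l x \<otimes> A l ?N (y \<otimes>\<^bsub>G\<^esub> z) \<oplus> A 1 l x \<otimes> (\<Oplus>m\<in>{l+1..?N-1}. A l m y \<otimes> A m ?N z)
        = A 1 l x \<otimes> A l ?N y \<oplus> A 1 l x \<otimes> A l ?N z"
        by (subst (asm) (1 2) r_distr) (auto intro!: finsum_closed)
    qed auto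
    also have "\<dots> = ?s x y \<oplus> ?s x z"
      by (intro finsum_addf) auto
    finally have right: "?s x (y \<otimes>\<^bsub>G\<^esub> z) \<oplus> ?W = ?s x y \<oplus> ?s x z" .
    \<comment> \<open>For \<open>left\<close> and \<open>right\<close>, \<open>p1\<close> is c(x, z)
      and \<open>w\<close> is \<open>?W\<close>; both drop out of the cocycle identity.\<close>
    have cancel: "p2 \<oplus> (\<ominus> q1 \<oplus> q2) \<oplus> \<ominus> p3 = \<zero>"
      if "q1 \<oplus> w = p1 \<oplus> p2" "q2 \<oplus> w = p3 \<oplus> p1" "p1 \<in> carrier R" "p2 \<in> carrier R"
        "p3 \<in> carrier R" "q1 \<in> carrier R" "q2 \<in> carrier R" "w \<in> carrier R" for p1 p2 p3 q1 q2 w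
    proof -
      have "p2 \<oplus> (\<ominus> q1 \<oplus> q2) \<oplus> \<ominus> p3 = (p1 \<oplus> p2) \<oplus> \<ominus> (q1 \<oplus> w) \<oplus> ((q2 \<oplus> w) \<oplus> \<ominus> (p3 \<oplus> p1))"
        using that(3-) by algebra
      then show ?thesis
        using that by (simp add: r_neg)
    qed
    show "?c (tuple [y, z]) \<oplus> (\<ominus> ?c (tuple [x \<otimes>\<^bsub>G\<^esub> y, z]) \<oplus> ?c (tuple [x, y \<otimes>\<^bsub>G\<^esub> z]))
        \<oplus> \<ominus> ?c (tuple [x, y]) = \<zero>"
      unfolding c[OF G(2,3)] c[OF G.m_closed[OF G(1,2)] G(3)] c[OF G(1) G.m_closed[OF G(2,3)]] c[OF G(1,2)]
      by (rule cancel[OF left right]) (rule scl Wcl)+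
  qed
qed

text \<open>A cup product of two cocycles is the value of a twofold Massey product, so this is the
  case \<open>n = 2\<close> of \<open>massey_sum_cocycle\<close>.\<close>

lemma cup_cocycle:
  assumes "f \<in> cocycles R G T 1" "h \<in> cocycles R G T 1"
  shows "cup R T 1 1 f h \<in> cocycles R G T 2"
proof -
  have fh: "f \<in> carrier (C 1)" "h \<in> carrier (C 1)" "d 1 f = \<zero>\<^bsub>C 2\<^esub>" "d 1 h = \<zero>\<^bsub>C 2\<^esub>"
    using assms by (simp_all add: cocycles_def numeral_2_eq_2)
  let ?a = "\<lambda>(i::nat) (j::nat). if i = 1 then f else h"
  have "(\<Oplus>\<^bsub>C 2\<^esub>k\<in>{2..2}. cup R T 1 1 (?a 1 k) (?a k (2 + 1))) \<in> cocycles R G T 2"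
  proof (rule massey_sum_cocycle[where n=2 and a="?a"])
    fix i j :: nat assume "1 \<le> i" "i < j" "j \<le> 2 + 1" "(i, j) \<noteq> (1, 2 + 1)"
    \<comment> \<open>The only admissible positions are (1, 2) and (2, 3), both on the first
      superdiagonal.\<close>
    then have "{i+1..j-1} = {}" by auto
    then show "d 1 (?a i j) = (\<Oplus>\<^bsub>C 2\<^esub>l\<in>{i+1..j-1}. cup R T 1 1 (?a i l) (?a l j))"
      using fh by (simp del: One_nat_def)
  qed (use fh in auto)
  then show ?thesis
    using cup_closed[OF fh(1,2)] by (simp del: One_nat_def)
qed

section \<open>Vanishing from one-dimensional H^2 and a non-degenerate cup product\<close>

theorem vanishing_massey_if_cup_perfect:
  assumes n: "n \<ge> 3" and "field R"
    and fin_dim: "vectorspace.fin_dim R (cohomology R G T 2)"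
    and dim: "vectorspace.dim R (cohomology R G T 2) = 1"
    and nondeg: "cup_nondegenerate R G T"
  shows "vanishing_massey R G T n"
  unfolding vanishing_massey_def
proof (intro allI impI)
  fix \<alpha> assume \<alpha>: "\<forall>i\<in>{1..n}. \<alpha> i \<in> carrier (cohomology R G T 1)"
    and "massey_product R G T n \<alpha> \<noteq> {}"
  then obtain a where a: "defining_system R G T n \<alpha> a"
    by (auto simp: massey_product_def)
  interpret V: vectorspace R "cohomology R G T 2"
    by (intro vectorspace.intro cohomology_2_module \<open>field R\<close>)
  define ok where "ok i j \<longleftrightarrow> 1 \<le> i \<and> i < j \<and> j \<le> n + 1 \<and> (i, j) \<noteq> (1, n + 1)" for i j
  have acl: "a i j \<in> carrier (C 1)" if "ok i j" for i j
    using a that unfolding defining_system_def ok_def by blast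
  have a_gt: "d 1 (a i j) = (\<Oplus>\<^bsub>C 2\<^esub>l\<in>{i+1..j-1}. cup R T 1 1 (a i l) (a l j))"
    if "ok i j" "j > i + 1" for i j
    using a that unfolding defining_system_def ok_def by blast
  have a_Suc: "a i (i + 1) \<in> \<alpha> i" if "i \<in> {1..n}" for i
    using a[unfolded defining_system_def, rule_format, of i "i + 1"] that n by auto
  \<comment> \<open>Classes in H^1 are singletons, so the superdiagonal entries are forced and any
    other defining system must share them.\<close>
  have cocycle: "a i (i + 1) \<in> cocycles R G T 1" "\<alpha> i = {a i (i + 1)}" if i: "i \<in> {1..n}" for i
  proof -
    obtain f where "f \<in> cocycles R G T 1" "\<alpha> i = cohomology_class R G T 1 f"
      using \<alpha> i unfolding carrier_cohomology by blast
    then have "f \<in> cocycles R G T 1" "\<alpha> i = {f}"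
      by (simp_all add: cocycles_def cohomology_class_1 del: One_nat_def)
    then show "a i (i + 1) \<in> cocycles R G T 1" "\<alpha> i = {a i (i + 1)}"
      using a_Suc[OF i] by auto
  qed
  \<comment> \<open>Next to the diagonal the sum is empty and the equation is the cocycle condition;
    this uniform version is the one \<open>massey_sum_cocycle\<close> expects.\<close>
  have da: "d 1 (a i j) = (\<Oplus>\<^bsub>C 2\<^esub>l\<in>{i+1..j-1}. cup R T 1 1 (a i l) (a l j))"
    if "ok i j" for i j
  proof (cases "j = i + 1")
    case True
    then have "a i j \<in> cocycles R G T 1" using that cocycle(1)[of i] by (auto simp: ok_def)
    then show ?thesis
      using True by (simp add: cocycles_def numeral_2_eq_2)
  next
    case False
    then show ?thesis using that by (intro a_gt) (auto simp: ok_def)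
  qed
  let ?f = "a 1 2" and ?N = "n + 1"
  have f: "?f \<in> cocycles R G T 1" "\<alpha> 1 = {?f}"
    using cocycle[of 1] n by (simp_all add: numeral_2_eq_2)
  have fcl: "?f \<in> carrier (C 1)"
    using f by (simp add: cocycles_def)
  show "\<zero>\<^bsub>cohomology R G T 2\<^esub> \<in> massey_product R G T n \<alpha>"
  proof (cases "?f = \<zero>\<^bsub>C 1\<^esub>")
    case True
    \<comment> \<open>The first row becomes zero. The case assumption keeps its entry at (1, 2) in
      \<open>\<alpha> 1\<close>.\<close>
    define b where "b i j = (if i = 1 then \<zero>\<^bsub>C 1\<^esub> else a i j)" for i j :: nat
    have bcl: "b i j \<in> carrier (C 1)" if "ok i j" for i j
      using that acl by (simp add: b_def)
    \<comment> \<open>Taken with \<open>m = j - 1\<close> for the equations of the first row, and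
      with \<open>m = n\<close>, \<open>j = n + 1\<close> for the Massey value.\<close>
    have zero_sum: "(\<Oplus>\<^bsub>C 2\<^esub>l\<in>{2..m}. cup R T 1 1 (b 1 l) (b l j)) = \<zero>\<^bsub>C 2\<^esub>"
      if "m < j" "j \<le> ?N" for m j
    proof -
      have "(\<Oplus>\<^bsub>C 2\<^esub>l\<in>{2..m}. cup R T 1 1 (b 1 l) (b l j)) = (\<Oplus>\<^bsub>C 2\<^esub>l\<in>{2..m}. \<zero>\<^bsub>C 2\<^esub>)"
      proof (rule C.M.finsum_cong')
        fix l assume "l \<in> {2..m}"
        then have "b l j \<in> carrier (C 1)" using that by (intro bcl) (auto simp: ok_def)
        then show "cup R T 1 1 (b 1 l) (b l j) = \<zero>\<^bsub>C 2\<^esub>"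
          unfolding b_def[of 1 l] using cup_zero_left by (simp del: One_nat_def)
      qed auto
      then show ?thesis by simp
    qed
    have "d 1 (b i j) = (\<Oplus>\<^bsub>C 2\<^esub>l\<in>{i+1..j-1}. cup R T 1 1 (b i l) (b l j))" if ij: "ok i j" for i j
    proof (cases "i = 1")
      case True
      have "d 1 \<zero>\<^bsub>C 1\<^esub> = \<zero>\<^bsub>C 2\<^esub>"
        using mod_hom.f0_is_0[OF differential_mod_hom[of 1]] by (simp add: numeral_2_eq_2)
      then show ?thesis
        using zero_sum[of "j - 1" j] ij True
        by (simp only: one_add_one b_def if_True refl) (auto simp: ok_def)
    next
      \<comment> \<open>The equation at (i, j) involves only rows from \<open>i\<close> on, so below
        the first row nothing changes.\<close>
      case False
      have "(\<Oplus>\<^bsub>C 2\<^esub>l\<in>{i+1..j-1}. cup R T 1 1 (b i l) (b l j))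
          = (\<Oplus>\<^bsub>C 2\<^esub>l\<in>{i+1..j-1}. cup R T 1 1 (a i l) (a l j))"
      proof (rule C.M.finsum_cong')
        show "(\<lambda>l. cup R T 1 1 (a i l) (a l j)) \<in> {i+1..j-1} \<rightarrow> carrier (C 2)"
          using ij by (intro Pi_I cup_closed acl) (auto simp: ok_def)
      qed (use ij False in \<open>auto simp: b_def ok_def\<close>)
      then show ?thesis
        using da[OF ij] False by (simp add: b_def)
    qed
    moreover have "b i (i + 1) \<in> \<alpha> i" if "i \<in> {1..n}" for i
      using a_Suc[OF that] f(2) True by (auto simp: b_def)
    ultimately have "defining_system R G T n \<alpha> b"
      using bcl unfolding defining_system_def ok_def by auto
    moreover have "massey_value R G T n b = \<zero>\<^bsub>cohomology R G T 2\<^esub>"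
      unfolding massey_value_def using zero_sum[of n ?N] by (simp only: cohomology_class_2_zero)
    ultimately show ?thesis
      unfolding massey_product_def by blast
  next
    case False
    obtain h where h: "h \<in> cocycles R G T 1"
      and fh: "cohomology_class R G T 2 (cup R T 1 1 ?f h) \<noteq> \<zero>\<^bsub>cohomology R G T 2\<^esub>"
    proof -
      have "\<alpha> 1 \<in> carrier (cohomology R G T 1)" using \<alpha> n by simp
      moreover have "\<alpha> 1 \<noteq> \<zero>\<^bsub>cohomology R G T 1\<^esub>"
        unfolding zero_cohomology coboundaries_1 f(2) using False by simp
      ultimately obtain Y where Y: "Y \<in> carrier (cohomology R G T 1)"
        "cohomology_cup R G T 1 1 (\<alpha> 1) Y \<noteq> \<zero>\<^bsub>cohomology R G T 2\<^esub>"
        using nondeg unfolding cup_nondegenerate_def by blast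
      then obtain h where h: "h \<in> cocycles R G T 1" "Y = cohomology_class R G T 1 h"
        unfolding carrier_cohomology by blast
      then have "Y = {h}"
        by (simp add: cocycles_def cohomology_class_1 del: One_nat_def)
      \<comment> \<open>With both classes singletons, the union in \<open>cohomology_cup\<close>
        runs over the single pair of \<open>?f\<close> and \<open>h\<close>.\<close>
      with Y(2) have "cohomology_class R G T 2 (cup R T 1 1 ?f h) \<noteq> \<zero>\<^bsub>cohomology R G T 2\<^esub>"
        unfolding cohomology_cup_def f(2) one_add_one by simp
      with h(1) show thesis by (rule that)
    qed
    have hcl: "h \<in> carrier (C 1)" and dh: "d 1 h = \<zero>\<^bsub>C 2\<^esub>"
      using h by (simp_all add: cocycles_def numeral_2_eq_2)
    let ?c = "\<Oplus>\<^bsub>C 2\<^esub>k\<in>{2..n}. cup R T 1 1 (a 1 k) (a k ?N)"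
    have c: "?c \<in> cocycles R G T 2"
      by (rule massey_sum_cocycle) (use acl da in \<open>simp_all add: ok_def del: One_nat_def\<close>)
    have fh_cocycle: "cup R T 1 1 ?f h \<in> cocycles R G T 2"
      by (rule cup_cocycle[OF f(1) h])
    have in_H2: "cohomology_class R G T 2 z \<in> carrier (cohomology R G T 2)"
      if "z \<in> cocycles R G T 2" for z
      using that unfolding carrier_cohomology by blast
    \<comment> \<open>The class of the cup product of \<open>?f\<close> and \<open>h\<close> spans
      H^2, so the value of the given system is a multiple of it.\<close>
    obtain s where s: "s \<in> carrier R" "cohomology_class R G T 2 ?c
        = s \<odot>\<^bsub>cohomology R G T 2\<^esub> cohomology_class R G T 2 (cup R T 1 1 ?f h)"
      using V.dim_1_scalar_multiple[OF fin_dim dim in_H2[OF fh_cocycle] fh in_H2[OF c]] .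
    \<comment> \<open>The coefficient is chosen so that multiplying by \<open>?f\<close> on the left
      contributes exactly the negative of the value of \<open>a\<close>.\<close>
    define e where "e = a 2 ?N \<oplus>\<^bsub>C 1\<^esub> (\<ominus> s) \<odot>\<^bsub>C 1\<^esub> h"
    define b where "b i j = (if i = 2 \<and> j = ?N then e else a i j)" for i j
    have ok2: "ok 2 ?N" using n by (simp add: ok_def)
    have ecl: "e \<in> carrier (C 1)"
      unfolding e_def using acl[OF ok2] hcl s(1) by (intro C.M.a_closed C.smult_closed) auto
    \<comment> \<open>The correction is a multiple of the cocycle \<open>h\<close> and is killed by
      the differential.\<close>
    have de: "d 1 e = d 1 (a 2 ?N)"
    proof -
      interpret D: mod_hom R "C 1" "C 2" "d 1"
        using differential_mod_hom[of 1] by (simp add: numeral_2_eq_2)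
      have "d 1 e = d 1 (a 2 ?N) \<oplus>\<^bsub>C 2\<^esub> (\<ominus> s) \<odot>\<^bsub>C 2\<^esub> d 1 h"
        unfolding e_def using acl[OF ok2] hcl s(1)
        by (simp only: D.f_add D.f_smult C.smult_closed a_inv_closed)
      then show ?thesis
        using D.f_im[OF acl[OF ok2]] s(1) unfolding dh by (simp only: C.smult_r_null C.M.r_zero a_inv_closed)
    qed
    have "d 1 (b i j) = (\<Oplus>\<^bsub>C 2\<^esub>l\<in>{i+1..j-1}. cup R T 1 1 (b i l) (b l j))" if ij: "ok i j" for i j
    proof -
      have "(\<Oplus>\<^bsub>C 2\<^esub>l\<in>{i+1..j-1}. cup R T 1 1 (b i l) (b l j))
          = (\<Oplus>\<^bsub>C 2\<^esub>l\<in>{i+1..j-1}. cup R T 1 1 (a i l) (a l j))"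
      proof (rule C.M.finsum_cong')
        show "(\<lambda>l. cup R T 1 1 (a i l) (a l j)) \<in> {i+1..j-1} \<rightarrow> carrier (C 2)"
          using ij by (intro Pi_I cup_closed acl) (auto simp: ok_def)
        fix l assume "l \<in> {i+1..j-1}"
        \<comment> \<open>The changed entry could enter the right-hand side only for
          \<open>i = 1\<close>, \<open>l = 2\<close>, \<open>j = n + 1\<close>, which is the
          excluded corner; as a left factor it would require \<open>j > n + 1\<close>.\<close>
        then have "b i l = a i l" "b l j = a l j"
          using ij by (auto simp: b_def ok_def)
        then show "cup R T 1 1 (b i l) (b l j) = cup R T 1 1 (a i l) (a l j)" by simp
      qed simp
      moreover have "d 1 (b i j) = d 1 (a i j)"
        using de by (auto simp: b_def)
      ultimately show ?thesis
        using da[OF ij] by (simp only:)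
    qed
    \<comment> \<open>Since \<open>n \<ge> 3\<close>, position (2, n + 1) is off the first
      superdiagonal, so the representatives are kept.\<close>
    moreover have "b i (i + 1) \<in> \<alpha> i" if "i \<in> {1..n}" for i
      using a_Suc[OF that] n by (auto simp: b_def)
    moreover have "b i j \<in> carrier (C 1)" if "ok i j" for i j
      using acl[OF that] ecl by (simp add: b_def)
    ultimately have "defining_system R G T n \<alpha> b"
      unfolding defining_system_def ok_def by auto
    moreover have "massey_value R G T n b = \<zero>\<^bsub>cohomology R G T 2\<^esub>"
    proof -
      let ?u = "cup R T 1 1 ?f h"
      \<comment> \<open>Only the summand for \<open>k = 2\<close> contains the changed
        entry.\<close>
      have split: "{2..n} = insert 2 {3..n}" using n by auto
      have summand: "cup R T 1 1 (a 1 k) (a k ?N) \<in> carrier (C 2)" if "k \<in> {2..n}" for k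
        using that by (intro cup_closed acl) (auto simp: ok_def)
      have ucl: "?u \<in> carrier (C 2)" by (rule cup_closed[OF fcl hcl])
      have "(\<Oplus>\<^bsub>C 2\<^esub>k\<in>{3..n}. cup R T 1 1 (b 1 k) (b k ?N))
          = (\<Oplus>\<^bsub>C 2\<^esub>k\<in>{3..n}. cup R T 1 1 (a 1 k) (a k ?N))" (is "?B = ?A")
        by (rule C.M.finsum_cong') (use summand in \<open>auto simp: b_def\<close>)
      moreover have Acl: "?A \<in> carrier (C 2)"
        by (rule C.M.finsum_closed) (use summand in auto)
      moreover have "cup R T 1 1 (b 1 2) (b 2 ?N) = cup R T 1 1 ?f (a 2 ?N) \<oplus>\<^bsub>C 2\<^esub> (\<ominus> s) \<odot>\<^bsub>C 2\<^esub> ?u"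
        using cup_add_smult_right[OF fcl acl[OF ok2] hcl a_inv_closed[OF s(1)]]
        by (simp add: b_def e_def)
      moreover have "(\<Oplus>\<^bsub>C 2\<^esub>k\<in>{2..n}. cup R T 1 1 (b 1 k) (b k ?N)) = cup R T 1 1 (b 1 2) (b 2 ?N) \<oplus>\<^bsub>C 2\<^esub> ?B"
        unfolding split
      proof (rule C.M.finsum_insert)
        have "b k ?N \<in> carrier (C 1)" "b 1 k \<in> carrier (C 1)" if "k \<in> {2..n}" for k
          using that acl ecl by (auto simp: b_def ok_def)
        then show "(\<lambda>k. cup R T 1 1 (b 1 k) (b k ?N)) \<in> {3..n} \<rightarrow> carrier (C 2)"
          "cup R T 1 1 (b 1 2) (b 2 ?N) \<in> carrier (C 2)"
          using n by (auto intro!: cup_closed simp del: One_nat_def)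
      qed auto
      moreover have "?c = cup R T 1 1 ?f (a 2 ?N) \<oplus>\<^bsub>C 2\<^esub> ?A"
        unfolding split by (rule C.M.finsum_insert) (use summand n in auto)
      moreover have "cup R T 1 1 ?f (a 2 ?N) \<oplus>\<^bsub>C 2\<^esub> (\<ominus> s) \<odot>\<^bsub>C 2\<^esub> ?u \<oplus>\<^bsub>C 2\<^esub> ?A
          = cup R T 1 1 ?f (a 2 ?N) \<oplus>\<^bsub>C 2\<^esub> ?A \<oplus>\<^bsub>C 2\<^esub> (\<ominus> s) \<odot>\<^bsub>C 2\<^esub> ?u"
      proof -
        have swap: "u \<oplus>\<^bsub>C 2\<^esub> v \<oplus>\<^bsub>C 2\<^esub> w = u \<oplus>\<^bsub>C 2\<^esub> w \<oplus>\<^bsub>C 2\<^esub> v"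
          if "u \<in> carrier (C 2)" "v \<in> carrier (C 2)" "w \<in> carrier (C 2)" for u v w
          using that by (simp add: C.M.a_ac)
        show ?thesis
          using summand[of 2] ucl Acl s(1) n by (intro swap C.smult_closed) auto
      qed
      ultimately have "(\<Oplus>\<^bsub>C 2\<^esub>k\<in>{2..n}. cup R T 1 1 (b 1 k) (b k ?N)) = ?c \<oplus>\<^bsub>C 2\<^esub> (\<ominus> s) \<odot>\<^bsub>C 2\<^esub> ?u"
        by (simp only:)
      \<comment> \<open>In H^2 the new value is \<open>s\<close> times the spanning class minus the
        same multiple.\<close>
      then have "massey_value R G T n b
          = cohomology_class R G T 2 (?c \<oplus>\<^bsub>C 2\<^esub> (\<ominus> s) \<odot>\<^bsub>C 2\<^esub> ?u)"
        by (simp only: massey_value_def)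
      also have "\<dots> = cohomology_class R G T 2 ?c \<oplus>\<^bsub>cohomology R G T 2\<^esub>
          (\<ominus> s) \<odot>\<^bsub>cohomology R G T 2\<^esub> cohomology_class R G T 2 ?u"
        using cohomology_2_smult[OF a_inv_closed[OF s(1)] fh_cocycle]
          cohomology_2_add[OF c submodule.smult_closed[OF submodule_cocycles a_inv_closed[OF s(1)] fh_cocycle]]
        by (simp only:)
      also have "\<dots> = (s \<oplus> \<ominus> s) \<odot>\<^bsub>cohomology R G T 2\<^esub> cohomology_class R G T 2 ?u"
        unfolding s(2) using V.smult_l_distr[OF s(1) a_inv_closed[OF s(1)] in_H2[OF fh_cocycle]] ..
      also have "\<dots> = \<zero>\<^bsub>cohomology R G T 2\<^esub>"
        using V.smult_l_null[OF in_H2[OF fh_cocycle]] s(1) by (simp only: r_neg)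
      finally show ?thesis .
    qed
    ultimately show ?thesis
      unfolding massey_product_def by blast
  qed
qed

end

section \<open>Application to Demushkin groups\<close>

theorem theorem4p3:
  fixes G :: "('g, 'm) monoid_scheme" and T :: "'g topology" and n p :: nat
  assumes "n \<ge> 3" and "prime p" and "demushkin_group p G T"
  shows "vanishing_massey (prime_field p) G T n"
proof -
  \<comment> \<open>Residues modulo a prime form a field, which supplies both the coefficients of
    the complex and the scalars of H^2.\<close>
  interpret P: residues_prime p "prime_field p"
    using \<open>prime p\<close> by (simp add: residues_prime_def)
  interpret cochain_complex "prime_field p" G T
  proof
    show "topological_group G T"
      using assms(3) by (simp add: demushkin_group_def pro_p_group_def profinite_group_def)
  qed
  show ?thesis
    using assms P.is_field by (intro vanishing_massey_if_cup_perfect) (simp_all add: demushkin_group_def)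
qed

end
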